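(* Let $\mu$ be an arbitrary probability measure on $\mathbb{C}$ and $X_1, X_2,\ldots$ iid with distribution $\mu$. For each $n$ let $k_n$ be a deterministic integer with $0\le k_n\le n$, $k_n = o(n)$, and let $\xi_1^{(n)}, \ldots, \xi_{k_n}^{(n)}$ be a deterministic triangular array of complex numbers. Assume there is a set $E \subset \mathbb{C}$ of Lebesgue measure zero such that for every $z \in \mathbb{C}\setminus E$, \[ \limsup_{n\to\infty} \frac{1}{n}\sum_{l=1}^{k_n}\log_-|z - \xi_l^{(n)}| = 0. \] Let $p_n(z) := \prod_{j=1}^{n-k_n}(z - X_j)\prod_{l=1}^{k_n}(z - \xi_l^{(n)})$. Then $\mu'_{p_n}$ converges weakly to $\mu$ in probability as $n\to\infty$.
   Context: $\log_- x := |\log x|$ for $0 \le x \le 1$ and $\log_- x := 0$ for $x \ge 1$, with $\log_-(0) := \infty$. For a polynomial $f$ of degree $n$, $\mu_f := \frac1n\sum_{f(z)=0}\delta_z$ (with multiplicity) and $\mu'_f := \mu_{f'}$. Weak convergence in probability of random measures $\nu_n$ to $\nu$ means $\int f\,d\nu_n \to \int f\,d\nu$ in probability for every bounded continuous $f:\mathbb{C}\to\mathbb{R}$. *)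

theory Defs
  imports "HOL-Probability.Probability" "HOL-Computational_Algebra.Polynomial"
    "HOL-Library.Landau_Symbols"
begin

definition log_minus :: "real \<Rightarrow> ereal" where
  "log_minus x = (if x = 0 then \<infinity> else if x \<le> 1 then ereal (\<bar>ln x\<bar>) else 0)"

text \<open>Integral of f against the normalized zero-counting measure mu_q of a polynomial q
  of degree m: (1/m) times the sum of f over the zeros of q, counted with multiplicity.\<close>
definition zero_measure_integral :: "complex poly \<Rightarrow> (complex \<Rightarrow> real) \<Rightarrow> real" where
  "zero_measure_integral q f =
     (\<Sum>z\<in>{z. poly q z = 0}. real (order z q) * f z) / real (degree q)"

definition deriv_zero_measure_integral :: "complex poly \<Rightarrow> (complex \<Rightarrow> real) \<Rightarrow> real" where
  "deriv_zero_measure_integral q f = zero_measure_integral (pderiv q) f"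

text \<open>p_n(z) = prod_{j=1}^{n-k_n} (z - X_j) prod_{l=1}^{k_n} (z - xi_l^(n)); indices shifted to start at 0.\<close>
definition p_poly :: "(nat \<Rightarrow> nat) \<Rightarrow> (nat \<Rightarrow> nat \<Rightarrow> complex) \<Rightarrow> (nat \<Rightarrow> complex) \<Rightarrow> nat \<Rightarrow> complex poly" where
  "p_poly k \<xi> x n = (\<Prod>j<n - k n. [:- x j, 1:]) * (\<Prod>l<k n. [:- \<xi> n l, 1:])"

end

theory Submission
  imports Defs "HOL-Complex_Analysis.Complex_Analysis"
    "HOL-Computational_Algebra.Fundamental_Theorem_Algebra"
begin

unbundle no fps_syntax

text \<open>
  Write \<open>p\<close> for the random polynomial of degree \<open>n\<close>, \<open>S = p'/p\<close> for the sum of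
  \<open>1/(z - a)\<close> over its zeros \<open>a\<close>, and \<open>L = ln |S|\<close>.
  For \<open>v \<noteq> 0\<close> the integral of \<open>ln |v + u|\<close> over a disc \<open>|u| < r\<close> equals the area of the disc times
  \<open>ln |v|\<close> plus an excess \<open>T v \<ge> 0\<close>, supported in \<open>|v| < r\<close>. Hence disc integrals of \<open>L\<close> around \<open>c\<close>
  differ from the area times \<open>L c\<close> by the sum of \<open>T (c - w)\<close> over the critical points \<open>w\<close> minus the
  same sum over the zeros of \<open>p\<close>. Since \<open>T\<close> is an approximate identity up to a constant,
  test functions integrate asymptotically equally against both zero counting measures as soon as
  the integral of \<open>|L|\<close> over every disc is \<open>o(n)\<close>.

  The positive part of \<open>L\<close> is deterministically small, because \<open>ln |S| \<le> ln n + |S|/n\<close> and \<open>1/|z|\<close> is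
  locally integrable. For the negative part, call a centre \<open>c\<close> good if \<open>|S c| \<ge> 1\<close>. At a good centre
  the disc identity bounds the disc integral of \<open>L\<close> from below by minus the sum of \<open>T (c - a)\<close>
  over the zeros \<open>a\<close>; integrating over all good centres controls the negative part
  everywhere, provided the bad centres have area at most half of that of the small disc. For a fixed
  centre, \<open>S c\<close> is a sum of independent identically distributed variables plus a constant, and if \<open>\<mu>\<close>
  is not a point mass, then a Gaussian smoothing of its characteristic function shows that
  \<open>|S c| < 1\<close> has probability tending to \<open>0\<close>. By Fubini and Markov the bad centres have small area with
  high probability. If \<open>\<mu>\<close> is a point mass at \<open>y\<close>, then all but \<open>k n\<close> of the critical points
  equal \<open>y\<close>.
\<close>

section \<open>Lebesgue measure and logarithms in the complex plane\<close>

lemma integrable_lborel_shift: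
  fixes f :: "'a::euclidean_space \<Rightarrow> real"
  assumes "integrable lborel f"
  shows "integrable lborel (\<lambda>x. f (c + x))"
proof -
  have "integrable (distr lborel borel ((+) c)) f"
    using assms by (simp add: lborel_distr_plus)
  thus ?thesis using assms
    by (subst (asm) integrable_distr_eq) auto
qed

lemma integral_lborel_shift:
  fixes f :: "'a::euclidean_space \<Rightarrow> real"
  assumes [measurable]: "f \<in> borel_measurable borel"
  shows "(LINT x|lborel. f (c + x)) = (LINT x|lborel. f x)"
proof -
  have "(LINT x|lborel. f x) = (LINT x|distr lborel borel ((+) c). f x)"
    by (simp add: lborel_distr_plus)
  also have "\<dots> = (LINT x|lborel. f (c + x))"
    by (subst integral_distr) auto
  finally show ?thesis by simp
qed

section \<open>Rotation invariance of planar Lebesgue measure\<close>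

text \<open>Coordinates in \<open>real ^ 2\<close>, where orthogonal transformations are known to
  preserve Lebesgue measure; \<open>complex\<close> inherits rotation invariance through
  them.\<close>

definition vec_of_complex :: "complex \<Rightarrow> real ^ 2" where
  "vec_of_complex z = (\<chi> i. if i = 1 then Re z else Im z)"

definition complex_of_vec :: "real ^ 2 \<Rightarrow> complex" where
  "complex_of_vec v = Complex (v $ 1) (v $ 2)"

lemma vec_of_complex_inverse [simp]: "complex_of_vec (vec_of_complex z) = z"
  by (simp add: vec_of_complex_def complex_of_vec_def complex_eq_iff)

lemma complex_of_vec_inverse [simp]: "vec_of_complex (complex_of_vec v) = v"
  by (simp add: vec_of_complex_def complex_of_vec_def vec_eq_iff forall_2)

lemma complex_of_vec_measurable [measurable]: "complex_of_vec \<in> borel_measurable borel"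
proof -
  have "complex_of_vec = (\<lambda>v. of_real (v $ 1) + \<i> * of_real (v $ 2))"
    by (auto simp: fun_eq_iff complex_of_vec_def complex_eq_iff)
  moreover have "continuous_on UNIV (\<lambda>v::real^2. of_real (v $ 1) + \<i> * of_real (v $ 2) :: complex)"
    by (intro continuous_intros)
  ultimately show ?thesis by (metis borel_measurable_continuous_onI)
qed

text \<open>Both measures give a box the product of its side lengths, and \<open>lborel\<close> is
  determined by its values on boxes.\<close>

lemma lborel_complex_eq_distr: "(lborel :: complex measure) = distr lborel borel complex_of_vec"
proof (rule lborel_eqI)
  fix l u :: complex
  assume lu: "\<And>b. b \<in> Basis \<Longrightarrow> l \<bullet> b \<le> u \<bullet> b"
  have le: "Re l \<le> Re u" "Im l \<le> Im u"
    using lu[of 1] lu[of \<i>] by (auto simp: Basis_complex_def)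
  have vim: "complex_of_vec -` box l u = box (vec_of_complex l) (vec_of_complex u)"
    by (auto simp: box_def Basis_complex_def Basis_vec_def forall_2 inner_axis
        vec_of_complex_def complex_of_vec_def)
  have "emeasure (distr lborel borel complex_of_vec) (box l u)
      = emeasure lborel (complex_of_vec -` box l u \<inter> space lborel)"
    by (subst emeasure_distr) auto
  also have "\<dots> = emeasure lborel (box (vec_of_complex l) (vec_of_complex u))"
    by (simp add: vim)
  also have "\<dots> = (\<Prod>b\<in>Basis. (vec_of_complex u - vec_of_complex l) \<bullet> b)"
    by (rule emeasure_lborel_box)
       (use le in \<open>auto simp: Basis_vec_def inner_axis vec_of_complex_def\<close>)
  also have "(\<Prod>b\<in>Basis. (vec_of_complex u - vec_of_complex l) \<bullet> b) = (\<Prod>i\<in>UNIV. (vec_of_complex u - vec_of_complex l) $ i)"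
    unfolding Basis_vec_def
    by (subst prod.UNION_disjoint) (auto simp: axis_eq_axis inner_axis)
  also have "\<dots> = (Re u - Re l) * (Im u - Im l)"
    by (simp add: UNIV_2 vec_of_complex_def)
  also have "\<dots> = (\<Prod>b\<in>Basis. (u - l) \<bullet> b)"
    by (simp add: Basis_complex_def)
  finally show "emeasure (distr lborel borel complex_of_vec) (box l u) = (\<Prod>b\<in>Basis. (u - l) \<bullet> b)" .
qed simp

lemma emeasure_lborel_complex:
  assumes "A \<in> sets borel"
  shows "emeasure lborel A = emeasure lborel (complex_of_vec -` A)"
  using assms by (subst lborel_complex_eq_distr, subst emeasure_distr) auto

text \<open>The preimage of a box under multiplication by \<open>a\<close> is its image under
  multiplication by \<open>cnj a\<close>, which acts on coordinates as an orthogonal transformation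
  and so keeps the area.\<close>

lemma lborel_distr_rotation:
  fixes a :: complex
  assumes a: "cmod a = 1"
  shows "distr lborel borel ((*) a) = lborel"
proof (rule lborel_eqI[symmetric])
  fix l u :: complex
  assume lu: "\<And>b. b \<in> Basis \<Longrightarrow> l \<bullet> b \<le> u \<bullet> b"
  define b where "b = cnj a"
  have b: "cmod b = 1" using a by (simp add: b_def)
  have ab: "a * b = 1" using a unfolding b_def
    by (metis complex_norm_square of_real_1 power_one)
  have vim: "(*) a -` S = (*) b ` S" for S
  proof (intro set_eqI iffI)
    fix x assume "x \<in> (*) a -` S"
    moreover have "x = b * (a * x)" using ab by (simp add: mult.assoc[symmetric] mult.commute[of b])
    ultimately show "x \<in> (*) b ` S" by blast
  next
    fix x assume "x \<in> (*) b ` S"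
    thus "x \<in> (*) a -` S" using ab by (auto simp: mult.assoc[symmetric])
  qed
  define rot where "rot = (\<lambda>v. vec_of_complex (b * complex_of_vec v))"
  have "orthogonal_transformation rot"
  proof -
    have "linear rot"
      by (rule linearI) (auto simp: rot_def vec_of_complex_def complex_of_vec_def vec_eq_iff algebra_simps)
    moreover have "norm (rot v) = norm v" for v
    proof -
      have nv: "norm (vec_of_complex z) = cmod z" for z
        by (simp add: norm_vec_def L2_set_def UNIV_2 vec_of_complex_def cmod_def)
      have "norm (rot v) = cmod (b * complex_of_vec v)" by (simp add: rot_def nv)
      also have "\<dots> = cmod (complex_of_vec v)" using b by (simp add: norm_mult)
      also have "\<dots> = norm v" by (metis nv complex_of_vec_inverse)
      finally show ?thesis .
    qed
    ultimately show ?thesis by (simp add: orthogonal_transformation)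
  qed
  note rot = this
  define V where "V = complex_of_vec -` box l u"
  have V: "V = box (vec_of_complex l) (vec_of_complex u)"
    by (auto simp: box_def Basis_complex_def Basis_vec_def forall_2 inner_axis
        vec_of_complex_def complex_of_vec_def V_def)
  have rotV: "complex_of_vec -` ((*) b ` box l u) = rot ` V"
  proof (intro set_eqI iffI)
    fix x assume "x \<in> complex_of_vec -` ((*) b ` box l u)"
    then obtain y where "complex_of_vec x = b * y" "y \<in> box l u" by auto
    thus "x \<in> rot ` V"
      by (intro image_eqI[of _ _ "vec_of_complex y"])
         (auto simp: rot_def V_def dest!: arg_cong[where f = vec_of_complex])
  next
    fix x assume "x \<in> rot ` V" thus "x \<in> complex_of_vec -` ((*) b ` box l u)"
      by (auto simp: rot_def V_def)
  qed
  have open_im: "open ((*) b ` box l u)"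
    unfolding vim[symmetric] by (intro open_vimage) (auto intro!: continuous_intros)
  have opr: "open (rot ` V)"
    unfolding rotV[symmetric] complex_of_vec_def [abs_def]
    by (intro open_vimage open_im)
       (auto intro!: continuous_intros simp: Complex_eq)
  have Vm: "V \<in> lmeasurable" by (simp add: V)
  have "emeasure (distr lborel borel ((*) a)) (box l u) = emeasure lborel ((*) b ` box l u)"
    by (subst emeasure_distr) (auto simp: vim)
  also have "\<dots> = emeasure lborel (rot ` V)"
    using open_im by (subst emeasure_lborel_complex) (auto simp: rotV)
  also have "\<dots> = emeasure lebesgue (rot ` V)"
    using opr by simp
  also have "\<dots> = measure lebesgue (rot ` V)"
    using measurable_orthogonal_image[OF rot Vm]
    by (simp add: emeasure_eq_measure2 fmeasurableD)
  also have "measure lebesgue (rot ` V) = measure lebesgue V"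
    by (rule measure_orthogonal_image[OF rot Vm])
  also have "ennreal (measure lebesgue V) = emeasure lebesgue V"
    using Vm by (simp add: emeasure_eq_measure2 fmeasurableD)
  also have "\<dots> = emeasure lborel V" by (simp add: V)
  also have "\<dots> = emeasure lborel (box l u)"
    by (subst emeasure_lborel_complex) (auto simp: V_def)
  also have "\<dots> = (\<Prod>b\<in>Basis. (u - l) \<bullet> b)"
    by (rule emeasure_lborel_box[OF lu])
  finally show "emeasure (distr lborel borel ((*) a)) (box l u) = (\<Prod>b\<in>Basis. (u - l) \<bullet> b)" .
qed simp

section \<open>Circle averages of logarithms\<close>

text \<open>Mean value property of the harmonic function \<open>ln |1 + w z|\<close>, which is
  \<open>0\<close> at the centre: Cauchy's formula is applied to \<open>Ln (1 + w z)\<close>,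
  holomorphic on the closed unit disc because \<open>1 + w z\<close> has positive real part
  there.\<close>

lemma has_integral_ln_circle_unit:
  fixes w :: complex
  assumes w: "cmod w < 1"
  shows "((\<lambda>t. ln (cmod (1 + w * cis t))) has_integral 0) {0..2*pi}"
proof -
  define g where "g = (\<lambda>z. Ln (1 + w * z))"
  have nonneg: "1 + w * z \<notin> \<real>\<^sub>\<le>\<^sub>0" if "z \<in> cball 0 1" for z
  proof
    assume "1 + w * z \<in> \<real>\<^sub>\<le>\<^sub>0"
    hence "Re (1 + w * z) \<le> 0" by (simp add: complex_nonpos_Reals_iff)
    moreover have "\<bar>Re (w * z)\<bar> \<le> cmod w * cmod z" by (metis abs_Re_le_cmod norm_mult)
    moreover have "cmod w * cmod z < 1" using w that
      by (smt (verit) mem_cball_0 mult_left_le norm_ge_zero)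
    ultimately show False by simp
  qed
  have hol: "g holomorphic_on cball 0 1"
    unfolding g_def using nonneg by (intro holomorphic_intros) auto
  have "((\<lambda>u. g u / (u - 0)) has_contour_integral (2 * of_real pi * \<i> * g 0)) (circlepath 0 1)"
    by (rule Cauchy_integral_circlepath_simple[OF hol]) auto
  hence "contour_integral (circlepath 0 1) (\<lambda>u. g u / u) = 0"
    by (simp add: contour_integral_unique g_def)
  hence 1: "integral {0..2*pi} (\<lambda>t. g (cis t) / cis t * \<i> * cis t) = 0"
    unfolding circlepath_def by (subst (asm) contour_integral_part_circlepath_eq) auto
  have 2: "(\<lambda>t. g (cis t) / cis t * \<i> * cis t) = (\<lambda>t. g (cis t) * \<i>)" by auto
  have cont: "continuous_on {0..2*pi} (\<lambda>t. g (cis t) * \<i>)"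
    unfolding g_def using nonneg by (intro continuous_intros) auto
  have "((\<lambda>t. g (cis t) * \<i>) has_integral 0) {0..2*pi}"
    using integrable_integral[OF integrable_continuous_interval[OF cont]] 1 2 by simp
  \<comment> \<open>The factor \<open>\<i>\<close> from the parametrisation of the circle turns the
    real part of \<open>Ln\<close>, which is the logarithm of the modulus, into an imaginary
    part.\<close>
  hence "((\<lambda>t. Im (g (cis t) * \<i>)) has_integral Im 0) {0..2*pi}"
    by (rule has_integral_Im)
  moreover have "Im (g (cis t) * \<i>) = ln (cmod (1 + w * cis t))" for t
    
  proof -
    have "1 + w * cis t \<noteq> 0" using nonneg[of "cis t"] by auto
    thus ?thesis by (simp add: g_def)
  qed
  ultimately show ?thesis by simp
qed

text \<open>The summand of larger modulus is factored out; what remains has the form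
  \<open>1 + w * cis t\<close> with \<open>|w| < 1\<close>, whose logarithm averages to
  zero.\<close>

lemma has_integral_ln_circle:
  fixes u v :: complex
  assumes "cmod u \<noteq> cmod v"
  shows "((\<lambda>t. ln (cmod (v + cis t * u))) has_integral 2 * pi * ln (max (cmod u) (cmod v))) {0..2*pi}"
proof (cases "cmod u < cmod v")
  case True
  hence v: "v \<noteq> 0" by auto
  have uv: "cmod (u / v) < 1" using True v by (simp add: norm_divide)
  have eq: "ln (cmod (v + cis t * u)) = ln (cmod v) + ln (cmod (1 + u / v * cis t))" for t
  proof -
    have "v + cis t * u = v * (1 + u / v * cis t)" using v by (simp add: field_simps)
    moreover have "1 + u / v * cis t \<noteq> 0"
    proof
      assume "1 + u / v * cis t = 0"
      hence "u / v * cis t = -1" by (simp add: add_eq_0_iff)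
      hence "cmod (u / v * cis t) = 1" by simp
      thus False using True by (auto simp: norm_mult norm_divide split: if_splits)
    qed
    ultimately show ?thesis using v by (simp add: norm_mult ln_mult)
  qed
  have "((\<lambda>t. ln (cmod v) + ln (cmod (1 + u / v * cis t))) has_integral (2*pi) * ln (cmod v) + 0) {0..2*pi}"
    using has_integral_const_real[of "ln (cmod v)" 0 "2*pi"]
    by (intro has_integral_add has_integral_ln_circle_unit uv) auto
  thus ?thesis using True by (simp add: eq max_def)
next
  case False
  hence lt: "cmod v < cmod u" using assms by auto
  hence u: "u \<noteq> 0" by auto
  \<comment> \<open>Factoring out \<open>u * cis t\<close> leaves \<open>cis (-t)\<close>;
    conjugation keeps the modulus and restores \<open>cis t\<close>.\<close>
  define w where "w = cnj (v / u)"
  have w: "cmod w < 1" using lt u by (simp add: w_def norm_divide)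
  have eq: "ln (cmod (v + cis t * u)) = ln (cmod u) + ln (cmod (1 + w * cis t))" for t
  proof -
    have "v + cis t * u = u * cis t * (1 + v / u * cis (-t))"
      using u by (simp add: field_simps cis_mult)
    moreover have "cmod (1 + v / u * cis (-t)) = cmod (cnj (1 + v / u * cis (-t)))" by (simp only: complex_mod_cnj)
    moreover have "cnj (1 + v / u * cis (-t)) = 1 + w * cis t" by (simp add: w_def cis_cnj)
    moreover have "1 + w * cis t \<noteq> 0"
    proof
      assume "1 + w * cis t = 0"
      hence "w * cis t = -1" by (simp add: add_eq_0_iff)
      hence "cmod (w * cis t) = 1" by simp
      thus False using w by (simp add: norm_mult)
    qed
    ultimately show ?thesis using u by (simp add: norm_mult ln_mult)
  qed
  have "((\<lambda>t. ln (cmod u) + ln (cmod (1 + w * cis t))) has_integral (2*pi) * ln (cmod u) + 0) {0..2*pi}"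
    using has_integral_const_real[of "ln (cmod u)" 0 "2*pi"]
    by (intro has_integral_add has_integral_ln_circle_unit w) auto
  thus ?thesis using lt by (simp add: eq max_def)
qed

lemma ball_in_borel [measurable]: "ball c r \<in> sets borel"
  by simp

section \<open>Local integrability of 1/|z|\<close>

text \<open>Dyadic decomposition: where \<open>(1/2)^(k+1) \<le> |u| < (1/2)^k\<close> the function
  is at most \<open>2^(k+1)\<close>, and the disc of radius \<open>(1/2)^k\<close> has area
  proportional to \<open>4^(-k)\<close>, so a geometric series dominates.\<close>

lemma nn_integral_inverse_cmod_ball:
  "(\<integral>\<^sup>+u. indicator (ball 0 1) u * ennreal (inverse (cmod u)) \<partial>lborel) < \<infinity>"
proof -
  define V where "V = unit_ball_vol 2"
  have V: "V \<ge> 0" unfolding V_def by (rule unit_ball_vol_nonneg) simp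
  have "(\<integral>\<^sup>+u. indicator (ball 0 1) u * ennreal (inverse (cmod u)) \<partial>lborel)
     \<le> (\<integral>\<^sup>+u. (\<Sum>k. ennreal (2 ^ Suc k) * indicator (ball (0::complex) ((1/2) ^ k)) u) \<partial>lborel)"
  proof (rule nn_integral_mono)
    fix u :: complex
    show "indicator (ball 0 1) u * ennreal (inverse (cmod u)) \<le>
       (\<Sum>k. ennreal (2 ^ Suc k) * indicator (ball (0::complex) ((1/2) ^ k)) u)"
    proof (cases "u = 0 \<or> cmod u \<ge> 1")
      \<comment> \<open>\<open>inverse 0 = 0\<close>, so the singular point contributes
        nothing.\<close>
      case True
      hence "indicator (ball 0 1) u * ennreal (inverse (cmod u)) = 0" by auto
      thus ?thesis by (simp only: zero_le)
    next
      case False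
      hence u: "cmod u > 0" "cmod u < 1" by auto
      obtain k where k: "(1/2) ^ k < cmod u"
        using real_arch_pow_inv[of "cmod u" "1/2"] u by auto
      \<comment> \<open>The index of the first dyadic radius not exceeding \<open>|u|\<close>; it is
        not \<open>0\<close> because \<open>|u| < 1\<close>, and its predecessor \<open>i\<close>
        gives the annulus containing \<open>u\<close>.\<close>
      define j where "j = (LEAST k. (1/2) ^ k \<le> cmod u)"
      have j: "(1/2) ^ j \<le> cmod u" unfolding j_def using k by (rule_tac LeastI[of _ k]) simp
      have "j \<noteq> 0" using j u by (cases j) auto
      then obtain i where i: "j = Suc i" by (cases j) auto
      have "\<not> (1/2) ^ i \<le> cmod u" using not_less_Least[of i "\<lambda>k. (1/2) ^ k \<le> cmod u"] i
        by (simp add: j_def)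
      hence ui: "u \<in> ball 0 ((1/2) ^ i)" by simp
      have "inverse (cmod u) \<le> 2 ^ Suc i"
        using j u unfolding i by (simp add: field_simps power_divide)
      hence "indicator (ball 0 1) u * ennreal (inverse (cmod u)) \<le>
          ennreal (2 ^ Suc i) * indicator (ball (0::complex) ((1/2) ^ i)) u"
        using ui u by (auto intro!: ennreal_leI simp: indicator_def)
      also have "\<dots> = (\<Sum>k\<in>{i}. ennreal (2 ^ Suc k) * indicator (ball (0::complex) ((1/2) ^ k)) u)"
        by (subst sum.insert) auto
      also have "\<dots> \<le> (\<Sum>k. ennreal (2 ^ Suc k) * indicator (ball (0::complex) ((1/2) ^ k)) u)"
        by (rule sum_le_suminf) auto
      finally show ?thesis .
    qed
  qed
  also have "\<dots> = (\<Sum>k. \<integral>\<^sup>+u. ennreal (2 ^ Suc k) * indicator (ball (0::complex) ((1/2) ^ k)) u \<partial>lborel)"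
    by (rule nn_integral_suminf) auto
  also have "\<dots> = (\<Sum>k. ennreal (2 * V * (1/2) ^ k))"
  proof (rule suminf_cong)
    fix k :: nat
    have "(\<integral>\<^sup>+u. ennreal (2 ^ Suc k) * indicator (ball (0::complex) ((1/2) ^ k)) u \<partial>lborel)
        = ennreal (2 ^ Suc k) * ennreal (V * ((1/2) ^ k)\<^sup>2)"
      by (subst nn_integral_cmult_indicator) (auto simp: emeasure_ball V_def)
    also have "\<dots> = ennreal (2 ^ Suc k * (V * ((1/2) ^ k)\<^sup>2))"
      using V by (subst ennreal_mult) auto
    also have "2 ^ Suc k * (V * ((1/2) ^ k)\<^sup>2) = 2 * V * (1/2) ^ k"
      by (simp add: power2_eq_square power_divide)
    finally show "(\<integral>\<^sup>+u. ennreal (2 ^ Suc k) * indicator (ball (0::complex) ((1/2) ^ k)) u \<partial>lborel)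
       = ennreal (2 * V * (1/2) ^ k)" .
  qed
  also have "\<dots> = ennreal (\<Sum>k. 2 * V * (1/2) ^ k)"
    using V by (intro suminf_ennreal2 summable_mult summable_geometric) auto
  also have "\<dots> < \<infinity>" by simp
  finally show ?thesis .
qed

text \<open>The numerical value is \<open>2 * pi\<close>; the proof treats it as an abstract
  nonnegative constant.\<close>

definition inv_ball_const :: real where
  "inv_ball_const = (LINT u:ball 0 1|lborel. inverse (cmod u))"

lemma inv_ball_const_nonneg: "inv_ball_const \<ge> 0"
  unfolding inv_ball_const_def set_lebesgue_integral_def by (rule integral_nonneg_AE) auto

lemma set_integrable_inverse_cmod_unit_ball:
  "set_integrable lborel (ball 0 1) (\<lambda>u. inverse (cmod u))"
  unfolding set_integrable_def
proof (rule integrableI_nonneg)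
  have "(\<integral>\<^sup>+u. ennreal (indicat_real (ball 0 1) u *\<^sub>R inverse (cmod u)) \<partial>lborel)
     = (\<integral>\<^sup>+u. indicator (ball 0 1) u * ennreal (inverse (cmod u)) \<partial>lborel)"
    by (intro nn_integral_cong) (auto simp: indicator_def)
  thus "(\<integral>\<^sup>+u. ennreal (indicat_real (ball 0 1) u *\<^sub>R inverse (cmod u)) \<partial>lborel) < \<infinity>"
    using nn_integral_inverse_cmod_ball by simp
  show "(\<lambda>u. indicat_real (ball 0 1) u *\<^sub>R inverse (cmod u)) \<in> borel_measurable lborel"
    by measurable
qed auto

text \<open>Within distance 1 of \<open>a\<close> the integrand is a translate of the function on
  the unit disc, and elsewhere it is at most 1. The bound does not depend on \<open>a\<close>, so it
  can later be averaged over arbitrary zeros.\<close>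

lemma
  fixes a :: complex
  assumes A [measurable]: "A \<in> sets borel" and fin: "emeasure lborel A < \<infinity>"
  shows set_integrable_inverse_cmod: "set_integrable lborel A (\<lambda>z. inverse (cmod (z - a)))"
    and set_integral_inverse_cmod_le:
      "(LINT z:A|lborel. inverse (cmod (z - a))) \<le> inv_ball_const + measure lborel A"
proof -
  define g where "g = (\<lambda>u. indicat_real (ball 0 1) u *\<^sub>R inverse (cmod u))"
  have g: "integrable lborel g"
    using set_integrable_inverse_cmod_unit_ball by (simp add: g_def set_integrable_def)
  have g': "integrable lborel (\<lambda>z. g (- a + z))"
    by (rule integrable_lborel_shift[OF g])
  have iA: "integrable lborel (indicat_real A)" using fin by simp
  have le: "indicat_real A z *\<^sub>R inverse (cmod (z - a)) \<le> g (- a + z) + indicat_real A z" for z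
  proof (cases "cmod (z - a) < 1")
    case True thus ?thesis by (auto simp: g_def indicator_def)
  next
    case False
    hence "inverse (cmod (z - a)) \<le> 1" by (simp add: inverse_le_1_iff)
    thus ?thesis using False by (auto simp: g_def indicator_def)
  qed
  show 1: "set_integrable lborel A (\<lambda>z. inverse (cmod (z - a)))"
    unfolding set_integrable_def
  proof (rule Bochner_Integration.integrable_bound[OF Bochner_Integration.integrable_add[OF g' iA]])
    show "AE z in lborel. norm (indicat_real A z *\<^sub>R inverse (cmod (z - a))) \<le> norm (g (- a + z) + indicat_real A z)"
      using le by (intro AE_I2) (auto simp: g_def)
  qed auto
  have "(LINT z:A|lborel. inverse (cmod (z - a))) \<le> (LINT z|lborel. g (- a + z) + indicat_real A z)"
    unfolding set_lebesgue_integral_def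
    using 1 le by (intro integral_mono Bochner_Integration.integrable_add g' iA) (auto simp: set_integrable_def)
  also have "\<dots> = (LINT z|lborel. g (- a + z)) + measure lborel A"
    using g' iA by (subst Bochner_Integration.integral_add) auto
  also have "(LINT z|lborel. g (- a + z)) = (LINT z|lborel. g z)"
    using g by (intro integral_lborel_shift) auto
  also have "\<dots> = inv_ball_const"
    by (simp add: inv_ball_const_def g_def set_lebesgue_integral_def)
  finally show "(LINT z:A|lborel. inverse (cmod (z - a))) \<le> inv_ball_const + measure lborel A" .
qed

section \<open>Disc integrals of a single logarithm\<close>

lemma abs_ln_le_add_inverse:
  fixes x :: real assumes "x \<ge> 0" shows "\<bar>ln x\<bar> \<le> x + inverse x"
proof (cases "x = 0")
  case False
  hence x: "x > 0" using assms by simp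
  have "ln x \<le> x" using ln_bound[OF x] by simp
  moreover have "ln (inverse x) \<le> inverse x" using x by (intro ln_bound) simp
  ultimately show ?thesis using x by (simp add: ln_inverse abs_le_iff) 
      (smt (verit) positive_imp_inverse_positive)
qed simp

text \<open>By \<open>|ln x| \<le> x + 1/x\<close> the logarithm is dominated on the disc by a
  constant plus an integrable reciprocal distance.\<close>

lemma set_integrable_ln_cmod:
  fixes a c :: complex
  shows "set_integrable lborel (ball c R) (\<lambda>z. ln (cmod (z - a)))"
proof -
  have fin: "emeasure lborel (ball c R) < \<infinity>" by (rule emeasure_bounded_finite) simp
  have 1: "set_integrable lborel (ball c R) (\<lambda>z. inverse (cmod (z - a)))"
    by (rule set_integrable_inverse_cmod) (use fin in auto)
  have 2: "set_integrable lborel (ball c R) (\<lambda>z. R + cmod (c - a))"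
    unfolding set_integrable_def using fin by (intro integrable_scaleR_left) auto
  have 3: "set_integrable lborel (ball c R) (\<lambda>z. (R + cmod (c - a)) + inverse (cmod (z - a)))"
    by (rule set_integral_add[OF 2 1])
  show ?thesis
    unfolding set_integrable_def
  proof (rule Bochner_Integration.integrable_bound[OF 3[unfolded set_integrable_def]])
    show "AE z in lborel. norm (indicat_real (ball c R) z *\<^sub>R ln (cmod (z - a)))
       \<le> norm (indicat_real (ball c R) z *\<^sub>R ((R + cmod (c - a)) + inverse (cmod (z - a))))"
    proof (rule AE_I2)
      fix z :: complex
      show "norm (indicat_real (ball c R) z *\<^sub>R ln (cmod (z - a)))
       \<le> norm (indicat_real (ball c R) z *\<^sub>R ((R + cmod (c - a)) + inverse (cmod (z - a))))"
      proof (cases "z \<in> ball c R")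
        case True
        hence "cmod (z - c) < R" by (simp add: dist_norm norm_minus_commute)
        hence "cmod (z - a) \<le> R + cmod (c - a)"
          using norm_triangle_ineq[of "z - c" "c - a"] by simp
        moreover have "\<bar>ln (cmod (z - a))\<bar> \<le> cmod (z - a) + inverse (cmod (z - a))"
          by (rule abs_ln_le_add_inverse) simp
        ultimately have "\<bar>ln (cmod (z - a))\<bar> \<le> (R + cmod (c - a)) + inverse (cmod (z - a))" by simp
        thus ?thesis using True by simp
      qed simp
    qed
    show "(\<lambda>z. indicat_real (ball c R) z *\<^sub>R ln (cmod (z - a))) \<in> borel_measurable lborel"
      by measurable
  qed
qed

text \<open>By \<open>disc_integral_ln\<close> below, the excess of the integral of \<open>u \<mapsto> ln |v + u|\<close> over the disc
  above its centre value times the area. At \<open>v = 0\<close> the convention \<open>x / 0 = 0\<close> makes it \<open>0\<close>.\<close>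
definition disc_excess :: "real \<Rightarrow> complex \<Rightarrow> real" where
  "disc_excess r v = (LINT u:ball 0 r|lborel. ln (max 1 (cmod u / cmod v)))"

lemma cmod_sphere_null: "AE u in lborel. cmod u \<noteq> s"
proof -
  have "negligible (sphere (0::complex) s)" by (rule negligible_sphere)
  hence "sphere (0::complex) s \<in> null_sets lborel"
    by (auto simp: negligible_iff_null_sets null_sets_completion_iff)
  hence "AE u in lborel. u \<notin> sphere (0::complex) s" by (rule AE_not_in)
  thus ?thesis by (rule eventually_mono) simp
qed

lemma ln_max_cmod:
  assumes "v \<noteq> (0::complex)"
  shows "ln (max (cmod u) (cmod v)) = ln (cmod v) + ln (max 1 (cmod u / cmod v))"
proof -
  have "max (cmod u) (cmod v) = cmod v * max 1 (cmod u / cmod v)"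
    using assms by (auto simp: max_def field_simps)
  moreover have "ln (cmod v * max 1 (cmod u / cmod v)) = ln (cmod v) + ln (max 1 (cmod u / cmod v))"
    using assms by (subst ln_mult) (auto simp: max_def)
  ultimately show ?thesis by simp
qed

text \<open>Averaging over the rotations \<open>u \<mapsto> cis t * u\<close> leaves the disc
  integral unchanged, and by Fubini it replaces the integrand by its circle mean
  \<open>ln (max |u| |v|)\<close>, which is \<open>ln |v|\<close> plus the integrand of the
  excess.\<close>

lemma disc_integral_ln:
  fixes v :: complex
  assumes v: "v \<noteq> 0"
  shows "(LINT u:ball 0 r|lborel. ln (cmod (v + u))) = measure lborel (ball (0::complex) r) * ln (cmod v) + disc_excess r v"
proof -
  define f where "f = (\<lambda>u. indicat_real (ball 0 r) u * ln (cmod (v + u)))"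
  have f: "integrable lborel f"
    using set_integrable_ln_cmod[of 0 r "-v"] by (simp add: f_def set_integrable_def add.commute)
  have fm [measurable]: "f \<in> borel_measurable borel" using f by auto
  have frot: "f (cis t * u) = indicat_real (ball 0 r) u * ln (cmod (v + cis t * u))" for t u
    by (simp add: f_def indicator_def norm_mult)
  have rot: "(LINT u|lborel. g (f (cis t * u))) = (LINT u|lborel. g (f u))"
    if [measurable]: "g \<in> borel_measurable borel" for t and g :: "real \<Rightarrow> real"
  proof -
    have "(LINT u|lborel. g (f u)) = (LINT u|distr lborel borel ((*) (cis t)). g (f u))"
      by (simp add: lborel_distr_rotation)
    also have "\<dots> = (LINT u|lborel. g (f (cis t * u)))"
      by (subst integral_distr) auto
    finally show ?thesis by simp
  qed
  have rotint: "integrable lborel (\<lambda>u. f (cis t * u))" for t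
  proof -
    have "integrable (distr lborel borel ((*) (cis t))) f" using f by (simp add: lborel_distr_rotation)
    thus ?thesis by (subst (asm) integrable_distr_eq) auto
  qed
  define h where "h = (\<lambda>t u. indicat_real {0..2*pi} t * f (cis t * u))"
  have cism [measurable]: "cis \<in> borel_measurable borel"
    by (intro borel_measurable_continuous_onI continuous_intros)
  have hint: "integrable (lborel \<Otimes>\<^sub>M lborel) (case_prod h)"
  proof (rule lborel_pair.Fubini_integrable)
    show "case_prod h \<in> borel_measurable (lborel \<Otimes>\<^sub>M lborel)"
      unfolding h_def by measurable
    have "(\<lambda>t. LINT u|lborel. norm (case_prod h (t, u))) = (\<lambda>t. indicat_real {0..2*pi} t * (LINT u|lborel. \<bar>f u\<bar>))"
      using rot[of abs] by (auto simp: h_def abs_mult)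
    thus "integrable lborel (\<lambda>t. LINT u|lborel. norm (case_prod h (t, u)))"
      by simp
    show "AE t in lborel. integrable lborel (\<lambda>u. case_prod h (t, u))"
      using rotint by (intro AE_I2) (simp add: h_def)
  qed
  have "(LINT u|lborel. LINT t|lborel. h t u) = (LINT t|lborel. LINT u|lborel. h t u)"
    by (rule lborel_pair.Fubini_integral[OF hint])
  also have "(\<lambda>t. LINT u|lborel. h t u) = (\<lambda>t. indicat_real {0..2*pi} t * (LINT u|lborel. f u))"
    using rot[of id] by (auto simp: h_def)
  also have "(LINT t|lborel. indicat_real {0..2*pi} t * (LINT u|lborel. f u)) = 2 * pi * (LINT u|lborel. f u)"
    by simp
  finally have 1: "(LINT u|lborel. LINT t|lborel. h t u) = 2 * pi * (LINT u|lborel. f u)" .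
  have inner: "(LINT t|lborel. h t u) = 2 * pi * (indicat_real (ball 0 r) u * ln (max (cmod u) (cmod v)))"
    if u: "cmod u \<noteq> cmod v" for u
  proof -
    have nz: "v + cis t * u \<noteq> 0" for t
    proof
      assume "v + cis t * u = 0"
      hence "v = - (cis t * u)" by (simp add: add_eq_0_iff)
      hence "cmod v = cmod u" by (simp add: norm_mult)
      thus False using u by simp
    qed
    have "set_integrable lborel {0..2*pi} (\<lambda>t. ln (cmod (v + cis t * u)))"
      using nz by (intro borel_integrable_atLeastAtMost' continuous_intros) auto
    hence "(LINT t:{0..2*pi}|lborel. ln (cmod (v + cis t * u))) = integral {0..2*pi} (\<lambda>t. ln (cmod (v + cis t * u)))"
      by (rule set_borel_integral_eq_integral)
    also have "\<dots> = 2 * pi * ln (max (cmod u) (cmod v))"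
      using has_integral_ln_circle[OF u] by (rule integral_unique)
    finally have e: "(LINT t|lborel. indicat_real {0..2*pi} t * ln (cmod (v + cis t * u))) = 2 * pi * ln (max (cmod u) (cmod v))"
      by (simp add: set_lebesgue_integral_def)
    have "(LINT t|lborel. h t u) = (LINT t|lborel. indicat_real (ball 0 r) u * (indicat_real {0..2*pi} t * ln (cmod (v + cis t * u))))"
      unfolding h_def frot by (intro Bochner_Integration.integral_cong) auto
    also have "\<dots> = indicat_real (ball 0 r) u * (2 * pi * ln (max (cmod u) (cmod v)))"
      using e by simp
    finally show ?thesis by simp
  qed
  have "(LINT u|lborel. LINT t|lborel. h t u) = (LINT u|lborel. 2 * pi * (indicat_real (ball 0 r) u * ln (max (cmod u) (cmod v))))"
  proof (rule integral_cong_AE)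
    \<comment> \<open>The circle mean is available only for \<open>|u| \<noteq> |v|\<close>; the
      exceptional circle is a null set.\<close>
    show "AE u in lborel. (LINT t|lborel. h t u) = 2 * pi * (indicat_real (ball 0 r) u * ln (max (cmod u) (cmod v)))"
      using cmod_sphere_null[of "cmod v"] by eventually_elim (rule inner)
    show "(\<lambda>u. LINT t|lborel. h t u) \<in> borel_measurable lborel"
      unfolding h_def by measurable
    show "(\<lambda>u. 2 * pi * (indicat_real (ball 0 r) u * ln (max (cmod u) (cmod v)))) \<in> borel_measurable lborel"
      by measurable
  qed
  also have "\<dots> = 2 * pi * (LINT u|lborel. indicat_real (ball 0 r) u * ln (max (cmod u) (cmod v)))"
    by simp
  finally have "(LINT u|lborel. f u) = (LINT u|lborel. indicat_real (ball 0 r) u * ln (max (cmod u) (cmod v)))"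
    using 1 by simp
  also have "\<dots> = (LINT u|lborel. ln (cmod v) * indicat_real (ball 0 r) u + indicat_real (ball 0 r) u * ln (max 1 (cmod u / cmod v)))"
    unfolding ln_max_cmod[OF v] distrib_left by (simp only: mult.commute)
  also have "\<dots> = (LINT u|lborel. ln (cmod v) * indicat_real (ball (0::complex) r) u) + disc_excess r v"
    unfolding disc_excess_def set_lebesgue_integral_def real_scaleR_def
  proof (rule Bochner_Integration.integral_add)
    have fin: "emeasure lborel (ball (0::complex) r) < \<infinity>" by (rule emeasure_bounded_finite) simp
    thus "integrable lborel (\<lambda>u. ln (cmod v) * indicat_real (ball (0::complex) r) u)" by simp
    have i: "integrable lborel (\<lambda>u. (r / cmod v) * indicat_real (ball (0::complex) r) u)" using fin by simp
    show "integrable lborel (\<lambda>u. indicat_real (ball (0::complex) r) u * ln (max 1 (cmod u / cmod v)))"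
    proof (rule Bochner_Integration.integrable_bound[OF i])
      show "AE u in lborel. norm (indicat_real (ball (0::complex) r) u * ln (max 1 (cmod u / cmod v)))
         \<le> norm (r / cmod v * indicat_real (ball (0::complex) r) u)"
      proof (intro AE_I2)
        fix u :: complex
        have "ln (max 1 (cmod u / cmod v)) \<le> cmod u / cmod v"
          by (auto simp: max_def intro: ln_bound)
        thus "norm (indicat_real (ball (0::complex) r) u * ln (max 1 (cmod u / cmod v)))
         \<le> norm (r / cmod v * indicat_real (ball (0::complex) r) u)"
        proof (cases "u \<in> ball 0 r")
          case True
          have "cmod u / cmod v \<le> r / cmod v" using True v by (intro divide_right_mono) auto
          moreover have "0 \<le> ln (max 1 (cmod u / cmod v))" by simp
          moreover have "r > 0" using True by (auto intro: le_less_trans[OF norm_ge_zero])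
          ultimately show ?thesis using True \<open>ln (max 1 (cmod u / cmod v)) \<le> cmod u / cmod v\<close> by simp
        qed simp
      qed
    qed measurable
  qed
  also have "(LINT u|lborel. ln (cmod v) * indicat_real (ball (0::complex) r) u) = measure lborel (ball (0::complex) r) * ln (cmod v)"
    by simp
  finally show ?thesis by (simp add: f_def set_lebesgue_integral_def)
qed

section \<open>Disc integrals of logarithms of polynomials\<close>

abbreviation disc_area :: "real \<Rightarrow> real" where
  "disc_area r \<equiv> measure lborel (ball (0::complex) r)"

lemma emeasure_disc_finite: "emeasure lborel (ball (c::complex) r) < \<infinity>"
  by (rule emeasure_bounded_finite) simp

lemma disc_area_pos: "r > 0 \<Longrightarrow> disc_area r > 0"
  using content_ball_pos[of r "0::complex"] by simp

section \<open>Size and support of the disc excess\<close>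

lemma ln_max_one_bounds:
  assumes "x \<ge> (0::real)"
  shows "0 \<le> ln (max 1 x)" "ln (max 1 x) \<le> x"
  using assms by (auto simp: max_def intro: ln_bound)

lemma disc_excess_nonneg: "disc_excess r v \<ge> 0"
  unfolding disc_excess_def set_lebesgue_integral_def
  by (rule integral_nonneg_AE) (auto intro!: AE_I2)

lemma disc_excess_integrand_le:
  "indicat_real (ball 0 r) u *\<^sub>R ln (max 1 (cmod u / cmod v)) \<le> r * inverse (cmod v) * indicat_real (ball 0 r) u"
proof (cases "u \<in> ball 0 r")
  case True
  have "ln (max 1 (cmod u / cmod v)) \<le> cmod u / cmod v" by (rule ln_max_one_bounds) simp
  also have "\<dots> \<le> r / cmod v" using True by (intro divide_right_mono) auto
  finally show ?thesis using True by (simp add: field_simps)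
qed simp

text \<open>For \<open>|v| \<ge> r\<close> the integrand vanishes; for \<open>|v| < r\<close> it is
  at most \<open>r / |v|\<close>. With \<open>x / 0 = 0\<close> both sides are \<open>0\<close> at
  \<open>v = 0\<close>. The bound records the support and an integrable singularity at once.\<close>

lemma disc_excess_le: "disc_excess r v \<le> disc_area r * r * (indicat_real (ball 0 r) v * inverse (cmod v))"
proof (cases "cmod v < r")
  case False
  have z: "indicat_real (ball 0 r) u *\<^sub>R ln (max 1 (cmod u / cmod v)) = 0" for u
  proof (cases "u \<in> ball 0 r \<and> v \<noteq> 0")
    case True
    hence "cmod u / cmod v \<le> 1" using False by (auto simp: field_simps)
    thus ?thesis by (simp add: max_def)
  qed auto
  have "disc_excess r v = 0" unfolding disc_excess_def set_lebesgue_integral_def z by simp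
  thus ?thesis using False by simp
next
  case True
  have "disc_excess r v \<le> (LINT u|lborel. r * inverse (cmod v) * indicat_real (ball (0::complex) r) u)"
    unfolding disc_excess_def set_lebesgue_integral_def
  proof (rule integral_mono_AE')
    show "integrable lborel (\<lambda>u. r * inverse (cmod v) * indicat_real (ball (0::complex) r) u)"
      using emeasure_disc_finite[of 0 r] by simp
    show "AE u in lborel. indicat_real (ball 0 r) u *\<^sub>R ln (max 1 (cmod u / cmod v)) \<le> r * inverse (cmod v) * indicat_real (ball 0 r) u"
      using disc_excess_integrand_le by (intro AE_I2) auto
    show "AE u in lborel. 0 \<le> r * inverse (cmod v) * indicat_real (ball (0::complex) r) u"
      using True by (intro AE_I2 mult_nonneg_nonneg) (auto intro: order_trans[OF norm_ge_zero less_imp_le])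
  qed
  also have "\<dots> = r * inverse (cmod v) * disc_area r" by simp
  finally show ?thesis using True by (simp add: mult_ac)
qed

lemma disc_excess_eq_0: "cmod v \<ge> r \<Longrightarrow> disc_excess r v = 0"
  using disc_excess_le[of r v] disc_excess_nonneg[of r v] by auto

lemma disc_excess_measurable [measurable]: "disc_excess r \<in> borel_measurable borel"
proof -
  have "(\<lambda>v. LINT u|lborel. indicat_real (ball 0 r) u *\<^sub>R ln (max 1 (cmod u / cmod v))) \<in> borel_measurable borel"
    by measurable
  thus ?thesis by (simp add: disc_excess_def[abs_def] set_lebesgue_integral_def)
qed

lemma integrable_disc_excess: "integrable lborel (disc_excess r)"
proof -
  have "set_integrable lborel (ball 0 r) (\<lambda>z. inverse (cmod (z - 0)))"
    using emeasure_disc_finite by (intro set_integrable_inverse_cmod) auto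
  hence i: "integrable lborel (\<lambda>v. disc_area r * r * (indicat_real (ball 0 r) v * inverse (cmod v)))"
    unfolding set_integrable_def by simp
  show ?thesis
    by (rule Bochner_Integration.integrable_bound[OF i])
       (auto intro!: AE_I2 order_trans[OF disc_excess_le abs_ge_self] simp: disc_excess_nonneg)
qed

text \<open>The reciprocal is integrated over the unit disc instead of the disc of radius
  \<open>r\<close>. The factor \<open>r\<close> left beyond the area makes the excess negligible for
  small discs.\<close>

lemma integral_disc_excess_le:
  assumes "0 < r" "r \<le> 1"
  shows "(LINT v|lborel. disc_excess r v) \<le> disc_area r * r * inv_ball_const"
proof -
  have i: "integrable lborel (\<lambda>v. indicat_real (ball 0 1) v * inverse (cmod v))"
    using set_integrable_inverse_cmod_unit_ball unfolding set_integrable_def by simp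
  have "(LINT v|lborel. disc_excess r v) \<le> (LINT v|lborel. disc_area r * r * (indicat_real (ball 0 1) v * inverse (cmod v)))"
  proof (rule integral_mono)
    fix v
    have "indicat_real (ball 0 r) v * inverse (cmod v) \<le> indicat_real (ball 0 1) v * inverse (cmod v)"
      using assms by (auto simp: indicator_def)
    hence "disc_area r * r * (indicat_real (ball 0 r) v * inverse (cmod v)) \<le> disc_area r * r * (indicat_real (ball 0 1) v * inverse (cmod v))"
      using assms by (intro mult_left_mono) auto
    thus "disc_excess r v \<le> disc_area r * r * (indicat_real (ball 0 1) v * inverse (cmod v))"
      using disc_excess_le[of r v] by linarith
  qed (use i integrable_disc_excess in auto)
  also have "\<dots> = disc_area r * r * inv_ball_const"
    by (simp add: inv_ball_const_def set_lebesgue_integral_def)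
  finally show ?thesis .
qed

text \<open>For \<open>0 < |v| < r\<close> the integrand is positive on the annulus
  \<open>|v| < |u| < r\<close>, which is open and nonempty and hence not null. Later estimates
  divide by this mass.\<close>

lemma integral_disc_excess_pos:
  assumes r: "0 < r"
  shows "(LINT v|lborel. disc_excess r v) > 0"
proof -
  have int: "integrable lborel (\<lambda>u. indicat_real (ball 0 r) u *\<^sub>R ln (max 1 (cmod u / cmod v)))" for v
  proof (rule Bochner_Integration.integrable_bound)
    show "integrable lborel (\<lambda>u. r * inverse (cmod v) * indicat_real (ball (0::complex) r) u)"
      using emeasure_disc_finite[of 0 r] by simp
    show "AE u in lborel. norm (indicat_real (ball 0 r) u *\<^sub>R ln (max 1 (cmod u / cmod v)))
        \<le> norm (r * inverse (cmod v) * indicat_real (ball (0::complex) r) u)"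
      using disc_excess_integrand_le[of r _ v] r by (intro AE_I2) (auto simp: abs_mult)
  qed measurable
  have pos: "disc_excess r v > 0" if v: "v \<noteq> 0" "cmod v < r" for v
  proof (rule ccontr)
    assume "\<not> disc_excess r v > 0"
    hence "disc_excess r v = 0" using disc_excess_nonneg[of r v] by simp
    hence "AE u in lborel. indicat_real (ball 0 r) u *\<^sub>R ln (max 1 (cmod u / cmod v)) = 0"
      unfolding disc_excess_def set_lebesgue_integral_def
      using integral_nonneg_eq_0_iff_AE[OF int, of v] by auto
    hence "AE u in lborel. u \<notin> ball (0::complex) r - cball 0 (cmod v)"
    proof eventually_elim
      case (elim u)
      show ?case
      proof
        assume u: "u \<in> ball 0 r - cball 0 (cmod v)"
        hence "cmod u / cmod v > 1" using v by auto
        hence "ln (max 1 (cmod u / cmod v)) > 0" by (simp add: max_def)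
        thus False using elim u by simp
      qed
    qed
    hence "ball 0 r - cball (0::complex) (cmod v) \<in> null_sets lborel"
      by (subst AE_iff_null_sets) auto
    moreover have "open (ball 0 r - cball (0::complex) (cmod v))" by (intro open_Diff) auto
    ultimately have "ball 0 r - cball (0::complex) (cmod v) = {}"
      using open_not_negligible negligible_iff_null_sets null_sets_completionI by blast
    \<comment> \<open>A point whose modulus lies midway between \<open>|v|\<close> and
      \<open>r\<close>.\<close>
    moreover have "of_real ((cmod v + r) / 2) \<in> ball 0 r - cball (0::complex) (cmod v)"
    proof -
      have "cmod (of_real ((cmod v + r) / 2)) = (cmod v + r) / 2"
        using r unfolding norm_of_real by simp
      thus ?thesis using v by (simp only: mem_ball_0 mem_cball_0 Diff_iff) simp
    qed
    ultimately show False by blast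
  qed
  show ?thesis
  proof (rule ccontr)
    assume "\<not> ?thesis"
    moreover have "(LINT v|lborel. disc_excess r v) \<ge> 0"
      by (rule integral_nonneg_AE) (auto simp: disc_excess_nonneg)
    ultimately have "(LINT v|lborel. disc_excess r v) = 0" by simp
    hence "AE v in lborel. disc_excess r v = 0"
      using integral_nonneg_eq_0_iff_AE[OF integrable_disc_excess[of r]] disc_excess_nonneg by auto
    hence "AE v in lborel. v \<notin> ball (0::complex) r - {0}"
      by eventually_elim (use pos in force)
    hence "ball 0 r - {0::complex} \<in> null_sets lborel"
      by (subst AE_iff_null_sets) auto
    hence "emeasure lborel (ball 0 r - {0::complex}) = 0" by auto
    moreover have "emeasure lborel (ball 0 r - {0::complex}) = emeasure lborel (ball (0::complex) r)"
      by (rule emeasure_Diff_null_set) auto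
    ultimately show False
      using disc_area_pos[OF r] by (simp add: measure_def)
  qed
qed

section \<open>An area form of Jensen's formula\<close>

lemma ln_cmod_poly:
  fixes q :: "complex poly"
  assumes "poly q z \<noteq> 0"
  shows "ln (cmod (poly q z)) = ln (cmod (lead_coeff q)) + (\<Sum>w\<in>#proots q. ln (cmod (z - w)))"
proof -
  have q: "q \<noteq> 0" using assms by auto
  have *: "poly (\<Prod>x\<in>#A. [:-x, 1:]) z \<noteq> 0 \<and> ln (cmod (poly (\<Prod>x\<in>#A. [:-x, 1:]) z)) = (\<Sum>w\<in>#A. ln (cmod (z - w)))"
    if "z \<notin># A" for A
    using that
  proof (induction A)
    case (add x A)
    hence "z \<noteq> x" "z \<notin># A" by auto
    moreover have "poly (\<Prod>x\<in>#add_mset x A. [:-x, 1:]) z = (z - x) * poly (\<Prod>x\<in>#A. [:-x, 1:]) z"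
      by (simp add: algebra_simps)
    ultimately show ?case using add.IH by (simp add: norm_mult ln_mult del: prod_mset.add_mset image_mset_add_mset)
  qed auto
  have z: "z \<notin># proots q" using assms q by simp
  have "poly q z = poly (smult (lead_coeff q) (\<Prod>x\<in>#proots q. [:-x, 1:])) z"
    by (simp only: complex_poly_decompose_multiset)
  also have "cmod \<dots> = cmod (lead_coeff q) * cmod (poly (\<Prod>x\<in>#proots q. [:-x, 1:]) z)"
    by (simp add: norm_mult)
  finally have "cmod (poly q z) = \<dots>" .
  thus ?thesis using *[OF z] q by (simp add: ln_mult)
qed

lemma finite_null_lborel: "finite A \<Longrightarrow> AE z in lborel. z \<notin> (A :: complex set)"
  by (rule AE_not_in) (auto intro: finite_imp_null_set_lborel)

lemma AE_poly_nonzero: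
  fixes q :: "complex poly"
  assumes "q \<noteq> 0"
  shows "AE z in lborel. poly q z \<noteq> 0"
  using finite_null_lborel[OF poly_roots_finite[OF assms]] by simp

lemma AE_lborel_shift:
  assumes "AE z in lborel. P (z :: complex)"
  shows "AE u in lborel. P (c + u)"
proof -
  have "AE z in distr lborel borel ((+) c). P z" using assms by (subst lborel_distr_plus)
  thus ?thesis by (rule AE_distrD[rotated]) simp
qed

lemma poly_measurable [measurable]: "(\<lambda>z. poly q z :: complex) \<in> borel_measurable borel"
  by (intro borel_measurable_continuous_onI continuous_intros)

lemma
  fixes A :: "complex multiset" and c :: complex
  shows set_integrable_sum_mset_ln: "set_integrable lborel (ball c r) (\<lambda>z. \<Sum>w\<in>#A. ln (cmod (z - w)))" (is ?a)
    and disc_integral_sum_mset_ln: "d \<notin># A \<Longrightarrow> (LINT u:ball 0 r|lborel. (\<Sum>w\<in>#A. ln (cmod (d + u - w))))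
      = disc_area r * (\<Sum>w\<in>#A. ln (cmod (d - w))) + (\<Sum>w\<in>#A. disc_excess r (d - w))"
proof -
  show ?a
  proof (induction A)
    case (add x A)
    thus ?case using set_integral_add(1)[OF set_integrable_ln_cmod[of c r x] add.IH] by simp
  qed (simp add: set_integrable_def)
  have int: "set_integrable lborel (ball 0 r) (\<lambda>u. ln (cmod (d + u - w)))" for w
    using set_integrable_ln_cmod[of 0 r "w - d"] by (simp add: algebra_simps)
  have int2: "set_integrable lborel (ball 0 r) (\<lambda>u. \<Sum>w\<in>#A. ln (cmod (d + u - w)))" for A
  proof (induction A)
    case (add x A)
    thus ?case using set_integral_add(1)[OF int[of x] add.IH] by simp
  qed (simp add: set_integrable_def)
  show "(LINT u:ball 0 r|lborel. (\<Sum>w\<in>#A. ln (cmod (d + u - w))))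
      = disc_area r * (\<Sum>w\<in>#A. ln (cmod (d - w))) + (\<Sum>w\<in>#A. disc_excess r (d - w))" if "d \<notin># A"
    using that
  proof (induction A)
    case (add x A)
    hence dx: "d - x \<noteq> 0" "d \<notin># A" by auto
    have "(LINT u:ball 0 r|lborel. (\<Sum>w\<in>#add_mset x A. ln (cmod (d + u - w))))
       = (LINT u:ball 0 r|lborel. ln (cmod (d + u - x))) + (LINT u:ball 0 r|lborel. (\<Sum>w\<in>#A. ln (cmod (d + u - w))))"
      using set_integral_add(2)[OF int[of x] int2[of A]] by simp
    also have "(LINT u:ball 0 r|lborel. ln (cmod (d + u - x))) = disc_area r * ln (cmod (d - x)) + disc_excess r (d - x)"
      using disc_integral_ln[OF dx(1), of r] by (simp add: algebra_simps)
    finally show ?case using add.IH dx(2) by (simp add: algebra_simps)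
  qed (simp add: set_lebesgue_integral_def)
qed

text \<open>Off the roots, \<open>ln |q|\<close> is a constant from the leading coefficient plus a
  sum over the roots, and the disc identity applies to each root. The centre \<open>d\<close> must
  not be a root, because \<open>ln 0 = 0\<close> there is only a convention.\<close>

lemma
  fixes q :: "complex poly" and c :: complex
  assumes q: "q \<noteq> 0"
  shows set_integrable_ln_poly: "set_integrable lborel (ball c r) (\<lambda>z. ln (cmod (poly q z)))" (is ?a)
    and disc_integral_ln_poly: "poly q d \<noteq> 0 \<Longrightarrow> (LINT u:ball 0 r|lborel. ln (cmod (poly q (d + u))))
      = disc_area r * ln (cmod (poly q d)) + (\<Sum>w\<in>#proots q. disc_excess r (d - w))"
proof -
  let ?l = "ln (cmod (lead_coeff q))"
  have cint: "set_integrable lborel (ball c r) (\<lambda>z. ?l)" for c :: complex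
    unfolding set_integrable_def using emeasure_disc_finite[of c r] by (intro integrable_scaleR_left) auto
  show ?a
    unfolding set_integrable_def
  proof (rule integrable_cong_AE_imp)
    show "integrable lborel (\<lambda>z. indicat_real (ball c r) z *\<^sub>R (?l + (\<Sum>w\<in>#proots q. ln (cmod (z - w)))))"
      using set_integral_add(1)[OF cint set_integrable_sum_mset_ln] by (simp add: set_integrable_def)
    show "AE z in lborel. indicat_real (ball c r) z *\<^sub>R (?l + (\<Sum>w\<in>#proots q. ln (cmod (z - w)))) =
        indicat_real (ball c r) z *\<^sub>R ln (cmod (poly q z))"
      using AE_poly_nonzero[OF q] by eventually_elim (simp add: ln_cmod_poly)
  qed measurable
  show "(LINT u:ball 0 r|lborel. ln (cmod (poly q (d + u))))
      = disc_area r * ln (cmod (poly q d)) + (\<Sum>w\<in>#proots q. disc_excess r (d - w))" if d: "poly q d \<noteq> 0"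
  proof -
    have int: "set_integrable lborel (ball 0 r) (\<lambda>u. \<Sum>w\<in>#proots q. ln (cmod (d + u - w)))"
    proof -
      have "integrable lborel (\<lambda>u. indicat_real (ball d r) (d + u) *\<^sub>R (\<Sum>w\<in>#proots q. ln (cmod (d + u - w))))"
        using integrable_lborel_shift[OF set_integrable_sum_mset_ln[of d r "proots q", unfolded set_integrable_def], of d] .
      moreover have "indicat_real (ball d r) (d + u) = indicat_real (ball 0 r) u" for u
        by (simp add: indicator_def dist_norm)
      ultimately show ?thesis by (simp add: set_integrable_def)
    qed
    have "(LINT u:ball 0 r|lborel. ln (cmod (poly q (d + u))))
        = (LINT u:ball 0 r|lborel. ?l + (\<Sum>w\<in>#proots q. ln (cmod (d + u - w))))"
      unfolding set_lebesgue_integral_def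
    proof (rule integral_cong_AE)
      show "AE u in lborel. indicat_real (ball 0 r) u *\<^sub>R ln (cmod (poly q (d + u))) =
         indicat_real (ball 0 r) u *\<^sub>R (?l + (\<Sum>w\<in>#proots q. ln (cmod (d + u - w))))"
        using AE_lborel_shift[OF AE_poly_nonzero[OF q], of d] by eventually_elim (simp add: ln_cmod_poly)
      show "(\<lambda>u. indicat_real (ball 0 r) u *\<^sub>R (?l + (\<Sum>w\<in>#proots q. ln (cmod (d + u - w))))) \<in> borel_measurable lborel"
        using set_integral_add(1)[OF cint int] by (auto simp: set_integrable_def)
    qed measurable
    also have "\<dots> = disc_area r * ?l + (disc_area r * (\<Sum>w\<in>#proots q. ln (cmod (d - w))) + (\<Sum>w\<in>#proots q. disc_excess r (d - w)))"
      using d q by (subst set_integral_add(2)[OF cint int], subst disc_integral_sum_mset_ln)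
        (auto simp: set_lebesgue_integral_def)
    also have "\<dots> = disc_area r * ln (cmod (poly q d)) + (\<Sum>w\<in>#proots q. disc_excess r (d - w))"
      by (simp add: ln_cmod_poly[OF d] algebra_simps)
    finally show ?thesis .
  qed
qed

lemma
  fixes g :: "complex \<Rightarrow> real"
  assumes g: "set_integrable lborel (ball c r) g"
  shows set_integrable_disc_shift: "set_integrable lborel (ball 0 r) (\<lambda>u. g (c + u))"
    and set_integral_disc_shift: "(LINT u:ball 0 r|lborel. g (c + u)) = (LINT z:ball c r|lborel. g z)"
proof -
  have ind: "indicat_real (ball c r) (c + u) = indicat_real (ball 0 r) u" for u
    by (simp add: indicator_def dist_norm)
  show "set_integrable lborel (ball 0 r) (\<lambda>u. g (c + u))"
    using integrable_lborel_shift[OF g[unfolded set_integrable_def], of c]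
    by (simp add: set_integrable_def ind)
  show "(LINT u:ball 0 r|lborel. g (c + u)) = (LINT z:ball c r|lborel. g z)"
    using integral_lborel_shift[of "\<lambda>z. indicat_real (ball c r) z *\<^sub>R g z" c] g
    by (simp add: set_integrable_def set_lebesgue_integral_def ind)
qed

lemma set_integral_nonneg_mono_set:
  fixes g :: "complex \<Rightarrow> real"
  assumes "set_integrable lborel B g" "A \<subseteq> B" "A \<in> sets borel" "\<And>z. g z \<ge> 0"
  shows "(LINT z:A|lborel. g z) \<le> (LINT z:B|lborel. g z)"
  unfolding set_lebesgue_integral_def
  by (rule integral_mono)
     (use assms set_integrable_subset[of lborel B g A] in \<open>auto simp: set_integrable_def indicator_def\<close>)

section \<open>Test functions and sums over zeros\<close>

text \<open>The excess is nonnegative and supported in \<open>|v| < r\<close>, where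
  \<open>f\<close> varies by at most \<open>e\<close>; divided by its mass it acts as an approximate
  identity.\<close>

lemma
  fixes f :: "complex \<Rightarrow> real"
  assumes f: "continuous_on UNIV f" and B: "\<And>z. \<bar>f z\<bar> \<le> B"
  shows integrable_mult_disc_excess: "integrable lborel (\<lambda>c. f c * disc_excess r (c - w))"
    and integral_mult_disc_excess_approx:
      "(\<And>x y. dist x y < r \<Longrightarrow> \<bar>f x - f y\<bar> \<le> e) \<Longrightarrow>
       \<bar>(LINT c|lborel. f c * disc_excess r (c - w)) - f w * (LINT v|lborel. disc_excess r v)\<bar>
         \<le> e * (LINT v|lborel. disc_excess r v)"
proof -
  have [measurable]: "f \<in> borel_measurable borel" using f by (rule borel_measurable_continuous_onI)
  have int: "integrable lborel (\<lambda>c. disc_excess r (c - w))"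
    using integrable_lborel_shift[OF integrable_disc_excess[of r], of "-w"] by simp
  have B0: "B \<ge> 0" using B[of 0] by linarith
  show 1: "integrable lborel (\<lambda>c. f c * disc_excess r (c - w))"
  proof (rule Bochner_Integration.integrable_bound)
    show "integrable lborel (\<lambda>c. B * disc_excess r (c - w))" using int by simp
    show "AE c in lborel. norm (f c * disc_excess r (c - w)) \<le> norm (B * disc_excess r (c - w))"
      using B B0 disc_excess_nonneg[of r] by (intro AE_I2) (auto simp: abs_mult intro!: mult_right_mono)
  qed measurable
  assume ucont: "\<And>x y. dist x y < r \<Longrightarrow> \<bar>f x - f y\<bar> \<le> e"
  let ?t = "LINT v|lborel. disc_excess r v"
  have t: "?t = (LINT c|lborel. disc_excess r (c - w))"
    using integral_lborel_shift[of "disc_excess r" "-w"] by simp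
  have "(LINT c|lborel. f c * disc_excess r (c - w)) - f w * ?t
      = (LINT c|lborel. f c * disc_excess r (c - w) - f w * disc_excess r (c - w))"
    unfolding t using 1 int by (subst Bochner_Integration.integral_diff) auto
  also have "\<bar>\<dots>\<bar> \<le> (LINT c|lborel. e * disc_excess r (c - w))"
  proof (rule order_trans[OF integral_abs_bound integral_mono])
    fix c
    show "\<bar>f c * disc_excess r (c - w) - f w * disc_excess r (c - w)\<bar> \<le> e * disc_excess r (c - w)"
    proof (cases "cmod (c - w) < r")
      case True
      hence "\<bar>f c - f w\<bar> \<le> e" by (intro ucont) (simp add: dist_norm)
      hence "\<bar>f c - f w\<bar> * disc_excess r (c - w) \<le> e * disc_excess r (c - w)"
        by (intro mult_right_mono disc_excess_nonneg)
      thus ?thesis using disc_excess_nonneg[of r "c - w"]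
        by (simp add: left_diff_distrib[symmetric] abs_mult)
    next
      case False
      thus ?thesis by (simp add: disc_excess_eq_0)
    qed
  qed (use 1 int in auto)
  also have "\<dots> = e * ?t" by (simp add: t)
  finally show "\<bar>(LINT c|lborel. f c * disc_excess r (c - w)) - f w * ?t\<bar> \<le> e * ?t" .
qed

lemma
  fixes f :: "complex \<Rightarrow> real"
  assumes f: "continuous_on UNIV f" and B: "\<And>z. \<bar>f z\<bar> \<le> B"
  shows integrable_mult_sum_disc_excess: "integrable lborel (\<lambda>c. f c * (\<Sum>w\<in>#A. disc_excess r (c - w)))"
    and integral_mult_sum_disc_excess:
      "(LINT c|lborel. f c * (\<Sum>w\<in>#A. disc_excess r (c - w))) = (\<Sum>w\<in>#A. LINT c|lborel. f c * disc_excess r (c - w))"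
proof -
  have "integrable lborel (\<lambda>c. f c * (\<Sum>w\<in>#A. disc_excess r (c - w))) \<and>
      (LINT c|lborel. f c * (\<Sum>w\<in>#A. disc_excess r (c - w))) = (\<Sum>w\<in>#A. LINT c|lborel. f c * disc_excess r (c - w))"
  proof (induction A)
    case (add x A)
    thus ?case using integrable_mult_disc_excess[OF assms, of r x] by (simp add: distrib_left)
  qed auto
  thus "integrable lborel (\<lambda>c. f c * (\<Sum>w\<in>#A. disc_excess r (c - w)))"
    "(LINT c|lborel. f c * (\<Sum>w\<in>#A. disc_excess r (c - w))) = (\<Sum>w\<in>#A. LINT c|lborel. f c * disc_excess r (c - w))"
    by auto
qed

lemma sum_mset_approx:
  fixes F f :: "'b \<Rightarrow> real" and e :: real
  assumes "\<And>w. \<bar>F w - f w * t\<bar> \<le> e"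
  shows "\<bar>(\<Sum>w\<in>#A. F w) - (\<Sum>w\<in>#A. f w) * t\<bar> \<le> size A * e"
proof (induction A)
  case (add x A)
  show ?case using assms[of x] add.IH by (simp add: algebra_simps)
qed auto

text \<open>A difference of logarithms rather than the logarithm of a quotient, so that
  integrability and the disc identity for the two polynomials can be subtracted.\<close>

definition log_ratio :: "complex poly \<Rightarrow> complex poly \<Rightarrow> complex \<Rightarrow> real" where
  "log_ratio q p z = ln (cmod (poly q z)) - ln (cmod (poly p z))"

lemma log_ratio_measurable [measurable]: "log_ratio q p \<in> borel_measurable borel"
  unfolding log_ratio_def[abs_def] by measurable

lemma set_integrable_log_ratio:
  assumes "q \<noteq> 0" "p \<noteq> 0"
  shows "set_integrable lborel (ball c r) (log_ratio q p)"
  unfolding log_ratio_def[abs_def] using assms by (intro set_integral_diff set_integrable_ln_poly)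

lemma disc_integral_log_ratio:
  assumes "poly q d \<noteq> 0" "poly p d \<noteq> 0"
  shows "(LINT u:ball 0 r|lborel. log_ratio q p (d + u))
     = disc_area r * log_ratio q p d + (\<Sum>w\<in>#proots q. disc_excess r (d - w)) - (\<Sum>w\<in>#proots p. disc_excess r (d - w))"
proof -
  have "q \<noteq> 0" "p \<noteq> 0" using assms by auto
  hence "(LINT u:ball 0 r|lborel. log_ratio q p (d + u))
     = (LINT u:ball 0 r|lborel. ln (cmod (poly q (d + u)))) - (LINT u:ball 0 r|lborel. ln (cmod (poly p (d + u))))"
    unfolding log_ratio_def
    by (intro set_integral_diff set_integrable_disc_shift[of d r "\<lambda>z. ln (cmod (poly _ z))"] set_integrable_ln_poly)
  thus ?thesis using assms \<open>q \<noteq> 0\<close> \<open>p \<noteq> 0\<close>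
    by (simp add: disc_integral_ln_poly) (simp add: log_ratio_def algebra_simps)
qed

text \<open>Each \<open>f w\<close> is replaced by the integral \<open>F w\<close> of
  \<open>f\<close> against the excess around \<open>w\<close>. The difference of the sums of
  \<open>F\<close> is an integral of \<open>f\<close> against a difference of excess sums, and the
  disc identity rewrites the latter as disc integral minus area times centre value of
  \<open>log_ratio q p\<close>. Thus only an \<open>L^1\<close> norm of \<open>log_ratio q p\<close>
  enters.\<close>

lemma sum_proots_diff_le:
  fixes f :: "complex \<Rightarrow> real" and p q :: "complex poly"
  assumes f: "continuous_on UNIV f" and B: "\<And>z. \<bar>f z\<bar> \<le> B"
    and supp: "\<And>z. cmod z \<ge> R \<Longrightarrow> f z = 0"
    and ucont: "\<And>x y. dist x y < r \<Longrightarrow> \<bar>f x - f y\<bar> \<le> e"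
    and r: "r > 0" and pq: "p \<noteq> 0" "q \<noteq> 0"
  shows "\<bar>(\<Sum>w\<in>#proots q. f w) - (\<Sum>w\<in>#proots p. f w)\<bar> * (LINT v|lborel. disc_excess r v)
     \<le> B * (disc_area R + disc_area r) * (LINT z:ball 0 (R + r)|lborel. \<bar>log_ratio q p z\<bar>)
       + (degree q + degree p) * (e * (LINT v|lborel. disc_excess r v))"
proof -
  let ?t = "LINT v|lborel. disc_excess r v"
  define J where "J = (LINT z:ball 0 (R + r)|lborel. \<bar>log_ratio q p z\<bar>)"
  define F where "F = (\<lambda>w. LINT c|lborel. f c * disc_excess r (c - w))"
  define Z where "Z = (\<lambda>p c. \<Sum>w\<in>#proots p. disc_excess r (c - w))"
  have B0: "B \<ge> 0" using B[of 0] by linarith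
  have absint: "set_integrable lborel (ball c s) (\<lambda>z. \<bar>log_ratio q p z\<bar>)" for c s
    using pq by (intro set_integrable_abs set_integrable_log_ratio)
  have approx: "\<bar>F w - f w * ?t\<bar> \<le> e * ?t" for w
    unfolding F_def by (rule integral_mult_disc_excess_approx[OF f B ucont])
  have intZ: "integrable lborel (\<lambda>c. f c * Z p c)" for p
    unfolding Z_def by (rule integrable_mult_sum_disc_excess[OF f B])
  have sumF: "(\<Sum>w\<in>#proots p. F w) = (LINT c|lborel. f c * Z p c)" for p
    unfolding F_def Z_def by (rule integral_mult_sum_disc_excess[OF f B, symmetric])
  have Z_le: "\<bar>Z q c - Z p c\<bar> \<le> J + disc_area r * \<bar>log_ratio q p c\<bar>"
    if c: "cmod c < R" "poly q c \<noteq> 0" "poly p c \<noteq> 0" for c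
  proof -
    have "Z q c - Z p c = (LINT u:ball 0 r|lborel. log_ratio q p (c + u)) - disc_area r * log_ratio q p c"
      unfolding Z_def using disc_integral_log_ratio[OF c(2,3)] by simp
    also have "(LINT u:ball 0 r|lborel. log_ratio q p (c + u)) = (LINT z:ball c r|lborel. log_ratio q p z)"
      using pq by (intro set_integral_disc_shift set_integrable_log_ratio)
    finally have eq: "Z q c - Z p c = (LINT z:ball c r|lborel. log_ratio q p z) - disc_area r * log_ratio q p c" .
    have "\<bar>LINT z:ball c r|lborel. log_ratio q p z\<bar> \<le> (LINT z:ball c r|lborel. \<bar>log_ratio q p z\<bar>)"
      using set_integral_norm_bound[OF set_integrable_log_ratio[OF pq(2,1), of c r]] by simp
    also have "\<dots> \<le> J" unfolding J_def
    proof (rule set_integral_nonneg_mono_set[OF absint])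
      show "ball c r \<subseteq> ball 0 (R + r)"
        using c(1) by (intro subsetI) (smt (verit) dist_commute dist_triangle dist_0_norm mem_ball)
    qed auto
    finally have "\<bar>LINT z:ball c r|lborel. log_ratio q p z\<bar> \<le> J" .
    thus ?thesis unfolding eq
      using abs_triangle_ineq4[of "LINT z:ball c r|lborel. log_ratio q p z" "disc_area r * log_ratio q p c"]
      by (simp add: abs_mult)
  qed
  have intR: "integrable lborel (\<lambda>c. indicat_real (ball (0::complex) R) c * J)"
    using emeasure_disc_finite[of 0 R] by simp
  have intR': "integrable lborel (\<lambda>c. indicat_real (ball 0 R) c * \<bar>log_ratio q p c\<bar>)"
    using absint[of 0 R] by (simp add: set_integrable_def)
  have "\<bar>(\<Sum>w\<in>#proots q. F w) - (\<Sum>w\<in>#proots p. F w)\<bar> = \<bar>LINT c|lborel. f c * Z q c - f c * Z p c\<bar>"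
    using intZ by (simp add: sumF)
  also have "\<dots> \<le> (LINT c|lborel. \<bar>f c * Z q c - f c * Z p c\<bar>)" by (rule integral_abs_bound)
  also have "\<dots> \<le> (LINT c|lborel. B * (indicat_real (ball 0 R) c * J + disc_area r * (indicat_real (ball 0 R) c * \<bar>log_ratio q p c\<bar>)))"
  proof (rule integral_mono_AE)
    show "AE c in lborel. \<bar>f c * Z q c - f c * Z p c\<bar> \<le> B * (indicat_real (ball 0 R) c * J + disc_area r * (indicat_real (ball 0 R) c * \<bar>log_ratio q p c\<bar>))"
      using AE_poly_nonzero[OF pq(1)] AE_poly_nonzero[OF pq(2)]
    proof eventually_elim
      case (elim c)
      show ?case
      proof (cases "cmod c < R")
        case True
        have "\<bar>f c * Z q c - f c * Z p c\<bar> = \<bar>f c\<bar> * \<bar>Z q c - Z p c\<bar>"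
          by (simp add: abs_mult[symmetric] right_diff_distrib)
        also have "\<dots> \<le> B * (J + disc_area r * \<bar>log_ratio q p c\<bar>)"
          using B B0 Z_le[OF True] elim by (intro mult_mono) auto
        finally show ?thesis using True by simp
      qed (use supp in auto)
    qed
  qed (use intZ intR intR' in auto)
  also have "\<dots> = B * (disc_area R * J + disc_area r * (LINT c:ball 0 R|lborel. \<bar>log_ratio q p c\<bar>))"
    using intR intR' by (simp add: set_lebesgue_integral_def)
  also have "\<dots> \<le> B * (disc_area R * J + disc_area r * J)"
  proof -
    have "(LINT c:ball 0 R|lborel. \<bar>log_ratio q p c\<bar>) \<le> J"
      unfolding J_def using r by (intro set_integral_nonneg_mono_set[OF absint] subset_ball) auto
    thus ?thesis using B0 by (intro mult_left_mono add_left_mono) auto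
  qed
  finally have 1: "\<bar>(\<Sum>w\<in>#proots q. F w) - (\<Sum>w\<in>#proots p. F w)\<bar> \<le> B * (disc_area R + disc_area r) * J"
    by (simp add: algebra_simps)
  have 2: "\<bar>(\<Sum>w\<in>#proots p. F w) - (\<Sum>w\<in>#proots p. f w) * ?t\<bar> \<le> degree p * (e * ?t)" for p
    using sum_mset_approx[OF approx, where A = "proots p"] by (simp add: size_proots_complex)
  have t: "?t > 0" by (rule integral_disc_excess_pos[OF r])
  have "\<bar>(\<Sum>w\<in>#proots q. f w) - (\<Sum>w\<in>#proots p. f w)\<bar> * ?t = \<bar>(\<Sum>w\<in>#proots q. f w) * ?t - (\<Sum>w\<in>#proots p. f w) * ?t\<bar>"
    using t by (simp add: left_diff_distrib[symmetric] abs_mult)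
  also have "\<dots> \<le> B * (disc_area R + disc_area r) * J + (degree q * (e * ?t) + degree p * (e * ?t))"
    using 1 2[of p] 2[of q] by linarith
  finally show ?thesis by (simp add: J_def algebra_simps)
qed

section \<open>The logarithmic derivative\<close>

definition monic_poly :: "(nat \<Rightarrow> complex) \<Rightarrow> nat \<Rightarrow> complex poly" where
  "monic_poly a n = (\<Prod>i<n. [:- a i, 1:])"

text \<open>The logarithmic derivative of \<open>monic_poly a n\<close> away from its zeros; since
  \<open>inverse 0 = 0\<close>, a pole situated at \<open>z\<close> drops out of the sum.\<close>

definition pole_sum :: "(nat \<Rightarrow> complex) \<Rightarrow> nat \<Rightarrow> complex \<Rightarrow> complex" where
  "pole_sum a n z = (\<Sum>i<n. inverse (z - a i))"

lemma pole_sum_measurable [measurable]: "pole_sum a n \<in> borel_measurable borel"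
  unfolding pole_sum_def[abs_def] by measurable

lemma monic_poly_nonzero [simp]: "monic_poly a n \<noteq> 0"
  by (auto simp: monic_poly_def)

lemma degree_monic_poly [simp]: "degree (monic_poly a n) = n"
  unfolding monic_poly_def by (subst degree_prod_sum_eq) auto

lemma proots_monic_poly: "proots (monic_poly a n) = image_mset a (mset_set {..<n})"
proof (induction n)
  case (Suc n)
  have "proots (monic_poly a (Suc n)) = proots (monic_poly a n) + proots [:- a n, 1:]"
    unfolding monic_poly_def prod.lessThan_Suc by (rule proots_mult) auto
  thus ?case using Suc by (simp add: lessThan_Suc)
qed (simp add: monic_poly_def)

lemma degree_pderiv_monic_poly [simp]: "degree (pderiv (monic_poly a n)) = n - 1"
  by (simp add: degree_pderiv)

lemma pderiv_monic_poly_nonzero: "n > 0 \<Longrightarrow> pderiv (monic_poly a n) \<noteq> 0"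
  by (simp add: pderiv_eq_0_iff)

lemma poly_pderiv_monic_poly:
  assumes "poly (monic_poly a n) z \<noteq> 0"
  shows "poly (pderiv (monic_poly a n)) z = poly (monic_poly a n) z * pole_sum a n z"
  using assms
proof (induction n)
  case (Suc n)
  have e: "monic_poly a (Suc n) = monic_poly a n * [:- a n, 1:]" by (simp add: monic_poly_def)
  have nz: "poly (monic_poly a n) z \<noteq> 0" "z - a n \<noteq> 0"
    using Suc.prems unfolding e by auto
  have "poly (pderiv (monic_poly a (Suc n))) z
      = poly (monic_poly a n) z + (z - a n) * (poly (monic_poly a n) z * pole_sum a n z)"
    unfolding e pderiv_mult using Suc.IH[OF nz(1)] by (simp add: pderiv_pCons algebra_simps)
  also have "\<dots> = poly (monic_poly a (Suc n)) z * pole_sum a (Suc n) z"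
    unfolding e using nz(2) by (simp add: pole_sum_def field_simps)
  finally show ?case .
qed (simp add: monic_poly_def pole_sum_def)

text \<open>Expressed by \<open>log_ratio\<close> so that the disc identity applies; it agrees with
  \<open>ln |pole_sum|\<close> away from the zeros of the polynomial and of its derivative.\<close>

definition log_deriv :: "(nat \<Rightarrow> complex) \<Rightarrow> nat \<Rightarrow> complex \<Rightarrow> real" where
  "log_deriv a n = log_ratio (pderiv (monic_poly a n)) (monic_poly a n)"

lemma log_deriv_measurable [measurable]: "log_deriv a n \<in> borel_measurable borel"
  unfolding log_deriv_def by measurable

lemma set_integrable_log_deriv: "n > 0 \<Longrightarrow> set_integrable lborel (ball c r) (log_deriv a n)"
  unfolding log_deriv_def by (intro set_integrable_log_ratio) (auto simp: pderiv_monic_poly_nonzero)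

lemma log_deriv_eq:
  assumes "poly (monic_poly a n) z \<noteq> 0" "pole_sum a n z \<noteq> 0"
  shows "log_deriv a n z = ln (cmod (pole_sum a n z))"
  using assms by (simp add: log_deriv_def log_ratio_def poly_pderiv_monic_poly norm_mult ln_mult)

section \<open>Positive and negative part of the logarithm\<close>

lemma set_integrable_pos_part:
  fixes g :: "complex \<Rightarrow> real"
  assumes "set_integrable lborel A g"
  shows "set_integrable lborel A (\<lambda>z. max 0 (g z))"
proof -
  have "integrable lborel (\<lambda>z. max 0 (indicat_real A z *\<^sub>R g z))"
    using assms by (intro integrable_max) (auto simp: set_integrable_def)
  moreover have "max 0 (indicat_real A z *\<^sub>R g z) = indicat_real A z *\<^sub>R max 0 (g z)" for z
    by (auto simp: indicator_def)
  ultimately show ?thesis by (simp add: set_integrable_def)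
qed

text \<open>Here \<open>ln |S| = ln n + ln (|S| / n) \<le> ln n + |S| / n\<close>, and
  \<open>|S|\<close> is at most a sum of \<open>n\<close> reciprocal distances whose integrals are
  bounded independently of the zeros. Division by \<open>n\<close> leaves a constant, uniformly in
  \<open>a\<close>.\<close>

lemma integral_log_deriv_pos_le:
  assumes n: "n > 0"
  shows "(LINT z:ball 0 R|lborel. max 0 (log_deriv a n z)) \<le> disc_area R * ln n + (inv_ball_const + disc_area R)"
proof -
  define H where "H = (\<lambda>z. \<Sum>i<n. inverse (cmod (z - a i)))"
  have fin: "emeasure lborel (ball (0::complex) R) < \<infinity>" by (rule emeasure_disc_finite)
  have intH1: "integrable lborel (\<lambda>z. indicat_real (ball 0 R) z * inverse (cmod (z - a i)))" for i
    using set_integrable_inverse_cmod[OF _ fin, of "a i"] by (simp add: set_integrable_def)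
  have intH: "integrable lborel (\<lambda>z. indicat_real (ball 0 R) z * H z)"
    unfolding H_def sum_distrib_left by (intro Bochner_Integration.integrable_sum intH1)
  have intc: "integrable lborel (\<lambda>z. indicat_real (ball (0::complex) R) z * ln n)" using fin by simp
  have "(LINT z:ball 0 R|lborel. max 0 (log_deriv a n z))
     \<le> (LINT z|lborel. indicat_real (ball 0 R) z * ln n + (indicat_real (ball 0 R) z * H z) / n)"
    unfolding set_lebesgue_integral_def
  proof (rule integral_mono_AE)
    show "integrable lborel (\<lambda>z. indicat_real (ball 0 R) z *\<^sub>R max 0 (log_deriv a n z))"
      using set_integrable_pos_part[OF set_integrable_log_deriv[OF n]] by (simp add: set_integrable_def)
    show "AE z in lborel. indicat_real (ball 0 R) z *\<^sub>R max 0 (log_deriv a n z)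
        \<le> indicat_real (ball 0 R) z * ln n + indicat_real (ball 0 R) z * H z / n"
      using AE_poly_nonzero[OF monic_poly_nonzero[of a n]] AE_poly_nonzero[OF pderiv_monic_poly_nonzero[OF n, of a]]
    proof eventually_elim
      case (elim z)
      hence S: "pole_sum a n z \<noteq> 0" by (auto simp: poly_pderiv_monic_poly)
      have L: "log_deriv a n z = ln (cmod (pole_sum a n z))" by (rule log_deriv_eq[OF elim(1) S])
      have SH: "cmod (pole_sum a n z) \<le> H z"
        unfolding pole_sum_def H_def using norm_sum[of "\<lambda>i. inverse (z - a i)" "{..<n}"]
        by (simp add: norm_inverse)
      have "ln (cmod (pole_sum a n z)) = ln n + ln (cmod (pole_sum a n z) / n)"
        using n S by (simp add: ln_div)
      also have "ln (cmod (pole_sum a n z) / n) \<le> cmod (pole_sum a n z) / n"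
        using n S by (intro ln_bound) auto
      also have "\<dots> \<le> H z / n" using SH by (intro divide_right_mono) auto
      finally have "log_deriv a n z \<le> ln n + H z / n" using L by simp
      moreover have "H z \<ge> 0" unfolding H_def by (intro sum_nonneg) auto
      ultimately have "max 0 (log_deriv a n z) \<le> ln n + H z / n" using n by auto
      thus ?case by (auto simp: indicator_def)
    qed
  qed (use intc intH in auto)
  also have "\<dots> = disc_area R * ln n + (LINT z|lborel. indicat_real (ball 0 R) z * H z) / n"
    using intc intH by simp
  also have "(LINT z|lborel. indicat_real (ball 0 R) z * H z) = (\<Sum>i<n. LINT z:ball 0 R|lborel. inverse (cmod (z - a i)))"
    unfolding H_def sum_distrib_left set_lebesgue_integral_def using intH1
    by (subst Bochner_Integration.integral_sum) auto
  also have "\<dots> / n \<le> (\<Sum>i<n. inv_ball_const + disc_area R) / n"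
    using set_integral_inverse_cmod_le[OF _ fin] by (intro divide_right_mono sum_mono) auto
  also have "\<dots> = inv_ball_const + disc_area R" using n by simp
  finally show ?thesis by simp
qed

text \<open>Lower bounds for disc integrals are averaged over the good centres, and every target
  point is covered by good discs whose centres fill at least half of \<open>disc_area r\<close>. The
  radii \<open>R\<close>, \<open>R + 1\<close> and \<open>R + 2\<close> contain the target points,
  the centres within \<open>r \<le> 1\<close> of them, and the discs around these centres.\<close>

lemma integral_log_deriv_neg_le:
  assumes n: "n > 0" and r: "0 < r" "r \<le> 1"
    and small: "measure lborel {c \<in> ball 0 (R + 1). cmod (pole_sum a n c) < 1} \<le> disc_area r / 2"
  shows "(LINT z:ball 0 R|lborel. max 0 (- log_deriv a n z))
    \<le> 2 * real n * r * inv_ball_const + 2 * disc_area (R + 1) / disc_area r * (LINT z:ball 0 (R + 2)|lborel. max 0 (log_deriv a n z))"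
proof -
  define Jp where "Jp = (LINT z:ball 0 (R + 2)|lborel. max 0 (log_deriv a n z))"
  define t where "t = (LINT v|lborel. disc_excess r v)"
  define bad where "bad = {c \<in> ball 0 (R + 1). cmod (pole_sum a n c) < 1}"
  define G where "G = ball 0 (R + 1) - bad"
  define Z where "Z = (\<lambda>c. \<Sum>i<n. disc_excess r (c - a i))"
  let ?L = "log_deriv a n"
  let ?N = "\<lambda>z. ennreal (max 0 (- ?L z))"
  have bad_m [measurable]: "bad \<in> sets borel" unfolding bad_def by measurable
  have G_m [measurable]: "G \<in> sets borel" unfolding G_def by measurable
  have Zm [measurable]: "Z \<in> borel_measurable borel" unfolding Z_def by measurable
  have Z0: "Z c \<ge> 0" for c unfolding Z_def by (intro sum_nonneg disc_excess_nonneg)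
  have intZ: "integrable lborel Z" "(LINT c|lborel. Z c) = n * t"
  proof -
    have i: "integrable lborel (\<lambda>c. disc_excess r (c - w))" for w
      using integrable_lborel_shift[OF integrable_disc_excess[of r], of "-w"] by simp
    thus "integrable lborel Z" unfolding Z_def by (intro Bochner_Integration.integrable_sum)
    have "(LINT c|lborel. disc_excess r (c - w)) = t" for w
      using integral_lborel_shift[of "disc_excess r" "-w"] by (simp add: t_def)
    thus "(LINT c|lborel. Z c) = n * t" unfolding Z_def using i by simp
  qed
  have Lpi: "set_integrable lborel (ball c s) (\<lambda>z. max 0 (?L z))" for c s
    by (intro set_integrable_pos_part set_integrable_log_deriv n)
  have Lni: "set_integrable lborel (ball c s) (\<lambda>z. max 0 (- ?L z))" for c s
    using set_integrable_log_deriv[OF n, of c s a]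
    by (intro set_integrable_pos_part) (simp add: set_integrable_def)
  have Jp0: "Jp \<ge> 0" unfolding Jp_def set_lebesgue_integral_def by (intro integral_nonneg_AE) auto
  have centre: "(\<integral>\<^sup>+z. indicator (ball 0 r) (z - c) * ?N z \<partial>lborel) \<le> ennreal (Jp + Z c)"
    if c: "c \<in> G" "poly (monic_poly a n) c \<noteq> 0" for c
  proof -
    have cR: "cmod c < R + 1" and S1: "cmod (pole_sum a n c) \<ge> 1"
      using c(1) by (auto simp: G_def bad_def)
    hence S0: "pole_sum a n c \<noteq> 0" by auto
    have L0: "?L c \<ge> 0" using S1 by (simp add: log_deriv_eq[OF c(2) S0])
    have p': "poly (pderiv (monic_poly a n)) c \<noteq> 0" using S0 c(2) by (simp add: poly_pderiv_monic_poly)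
    \<comment> \<open>In the disc identity the centre value and the excesses of the critical points
      are nonnegative, so only the excesses of the zeros remain as a negative term.\<close>
    have "(LINT u:ball 0 r|lborel. ?L (c + u)) \<ge> - Z c"
    proof -
      have 1: "disc_area r * ?L c \<ge> 0" using L0 by simp
      have 2: "(\<Sum>w\<in>#proots (pderiv (monic_poly a n)). disc_excess r (c - w)) \<ge> 0"
      proof -
        have "(\<Sum>w\<in>#A. disc_excess r (c - w)) \<ge> 0" for A
          by (induction A) (auto intro!: add_nonneg_nonneg disc_excess_nonneg)
        thus ?thesis .
      qed
      have 3: "(\<Sum>w\<in>#proots (monic_poly a n). disc_excess r (c - w)) = Z c"
        by (simp add: proots_monic_poly Z_def sum_unfold_sum_mset image_mset.compositionality o_def)
      show ?thesis using disc_integral_log_ratio[OF p' c(2), of r] 1 2 3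
        by (simp add: log_deriv_def)
    qed
    also have "(LINT u:ball 0 r|lborel. ?L (c + u)) = (LINT z:ball c r|lborel. ?L z)"
      by (intro set_integral_disc_shift set_integrable_log_deriv n)
    also have "\<dots> = (LINT z:ball c r|lborel. max 0 (?L z) - max 0 (- ?L z))"
      by (intro arg_cong[where f = "set_lebesgue_integral _ _"] ext) auto
    also have "\<dots> = (LINT z:ball c r|lborel. max 0 (?L z)) - (LINT z:ball c r|lborel. max 0 (- ?L z))"
      by (intro set_integral_diff Lpi Lni)
    finally have "(LINT z:ball c r|lborel. max 0 (- ?L z)) \<le> (LINT z:ball c r|lborel. max 0 (?L z)) + Z c" by simp
    also have "(LINT z:ball c r|lborel. max 0 (?L z)) \<le> Jp" unfolding Jp_def
    proof (rule set_integral_nonneg_mono_set[OF Lpi])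
      show "ball c r \<subseteq> ball 0 (R + 2)"
        using cR r by (intro subsetI) (smt (verit) dist_commute dist_triangle dist_0_norm mem_ball)
    qed auto
    finally have le: "(LINT z:ball c r|lborel. max 0 (- ?L z)) \<le> Jp + Z c" by simp
    have "(\<integral>\<^sup>+z. indicator (ball 0 r) (z - c) * ?N z \<partial>lborel)
        = (\<integral>\<^sup>+z. ennreal (indicat_real (ball c r) z *\<^sub>R max 0 (- ?L z)) \<partial>lborel)"
      by (intro nn_integral_cong) (auto simp: indicator_def dist_norm norm_minus_commute)
    also have "\<dots> = ennreal (LINT z:ball c r|lborel. max 0 (- ?L z))"
      unfolding set_lebesgue_integral_def
      using Lni[of c r] by (intro nn_integral_eq_integral) (auto simp: set_integrable_def)
    finally show ?thesis using le by (simp add: ennreal_leI)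
  qed
  have outer: "(\<integral>\<^sup>+c. indicator G c * (\<integral>\<^sup>+z. indicator (ball 0 r) (z - c) * ?N z \<partial>lborel) \<partial>lborel)
      \<le> ennreal (disc_area (R + 1) * Jp + n * t)"
  proof -
    have "(\<integral>\<^sup>+c. indicator G c * (\<integral>\<^sup>+z. indicator (ball 0 r) (z - c) * ?N z \<partial>lborel) \<partial>lborel)
       \<le> (\<integral>\<^sup>+c. ennreal (indicat_real (ball 0 (R + 1)) c * Jp + Z c) \<partial>lborel)"
    proof (rule nn_integral_mono_AE)
      show "AE c in lborel. indicator G c * (\<integral>\<^sup>+z. indicator (ball 0 r) (z - c) * ?N z \<partial>lborel)
           \<le> ennreal (indicat_real (ball 0 (R + 1)) c * Jp + Z c)"
        using AE_poly_nonzero[OF monic_poly_nonzero[of a n]]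
      proof eventually_elim
        case (elim c)
        show ?case
        proof (cases "c \<in> G")
          case True
          hence "indicat_real (ball 0 (R + 1)) c = 1" by (simp add: G_def)
          thus ?thesis using True centre[OF True elim] by simp
        qed simp
      qed
    qed
    also have "\<dots> = ennreal (LINT c|lborel. indicat_real (ball 0 (R + 1)) c * Jp + Z c)"
      using intZ Z0 Jp0 emeasure_disc_finite[of 0 "R + 1"]
      by (intro nn_integral_eq_integral Bochner_Integration.integrable_add) auto
    also have "(LINT c|lborel. indicat_real (ball 0 (R + 1)) c * Jp + Z c) = disc_area (R + 1) * Jp + n * t"
      using intZ emeasure_disc_finite[of 0 "R + 1"] by (subst Bochner_Integration.integral_add) auto
    finally show ?thesis .
  qed
  have inner: "ennreal (disc_area r / 2) \<le> (\<integral>\<^sup>+c. indicator G c * indicator (ball 0 r) (z - c) \<partial>lborel)"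
    if z: "z \<in> ball 0 R" for z
  proof -
    have sub: "ball z r \<subseteq> ball 0 (R + 1)"
      using z r by (intro subsetI) (smt (verit) dist_commute dist_triangle dist_0_norm mem_ball)
    have badf: "emeasure lborel bad < \<infinity>"
      by (intro emeasure_bounded_finite bounded_subset[OF bounded_ball[of 0 "R + 1"]]) (auto simp: bad_def)
    have Gf: "emeasure lborel (G \<inter> ball z r) < \<infinity>"
      using emeasure_mono[of "G \<inter> ball z r" "ball z r" lborel] emeasure_disc_finite[of z r]
      by (auto intro: le_less_trans)
    \<comment> \<open>The disc around \<open>z\<close> is covered by its good part and
      \<open>bad\<close>, and \<open>bad\<close> has at most half of its area.\<close>
    have "measure lborel (ball z r) \<le> measure lborel ((G \<inter> ball z r) \<union> bad)"
    proof (rule measure_mono_fmeasurable)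
      show "ball z r \<subseteq> (G \<inter> ball z r) \<union> bad" using sub by (auto simp: G_def)
      show "(G \<inter> ball z r) \<union> bad \<in> fmeasurable lborel"
        using badf Gf by (intro fmeasurable.Un) (auto simp: fmeasurable_def)
    qed auto
    also have "\<dots> \<le> measure lborel (G \<inter> ball z r) + measure lborel bad"
      by (intro measure_Un_le) auto
    also have "measure lborel (ball z r) = disc_area r" using r by (simp add: content_ball)
    finally have "disc_area r / 2 \<le> measure lborel (G \<inter> ball z r)"
      using small by (simp add: bad_def)
    hence "ennreal (disc_area r / 2) \<le> emeasure lborel (G \<inter> ball z r)"
      using Gf by (subst emeasure_eq_ennreal_measure) (auto simp: ennreal_leI)
    also have "\<dots> = (\<integral>\<^sup>+c. indicator (G \<inter> ball z r) c \<partial>lborel)" by simp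
    also have "\<dots> = (\<integral>\<^sup>+c. indicator G c * indicator (ball 0 r) (z - c) \<partial>lborel)"
      by (intro nn_integral_cong) (auto simp: indicator_def dist_norm norm_minus_commute[of z])
    finally show ?thesis .
  qed
  have "ennreal (disc_area r / 2 * (LINT z:ball 0 R|lborel. max 0 (- ?L z)))
      = ennreal (disc_area r / 2) * (\<integral>\<^sup>+z. indicator (ball 0 R) z * ?N z \<partial>lborel)"
  proof -
    have "(\<integral>\<^sup>+z. indicator (ball 0 R) z * ?N z \<partial>lborel) = (\<integral>\<^sup>+z. ennreal (indicat_real (ball 0 R) z *\<^sub>R max 0 (- ?L z)) \<partial>lborel)"
      by (intro nn_integral_cong) (auto simp: indicator_def)
    also have "\<dots> = ennreal (LINT z:ball 0 R|lborel. max 0 (- ?L z))"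
      unfolding set_lebesgue_integral_def
      using Lni[of 0 R] by (intro nn_integral_eq_integral) (auto simp: set_integrable_def)
    finally have e: "(\<integral>\<^sup>+z. indicator (ball 0 R) z * ?N z \<partial>lborel) = ennreal (LINT z:ball 0 R|lborel. max 0 (- ?L z))" .
    show ?thesis unfolding e by (rule ennreal_mult') simp
  qed
  also have "\<dots> = (\<integral>\<^sup>+z. ennreal (disc_area r / 2) * (indicator (ball 0 R) z * ?N z) \<partial>lborel)"
    by (rule nn_integral_cmult[symmetric]) measurable
  \<comment> \<open>Double counting: the lower bound on good centres near \<open>z\<close> is
    inserted, and then Fubini for nonnegative functions exchanges points and centres, so no joint
    integrability has to be checked.\<close>
  also have "\<dots> \<le> (\<integral>\<^sup>+z. (\<integral>\<^sup>+c. indicator G c * indicator (ball 0 r) (z - c) \<partial>lborel) * ?N z \<partial>lborel)"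
  proof (rule nn_integral_mono)
    fix z
    show "ennreal (disc_area r / 2) * (indicator (ball 0 R) z * ?N z)
       \<le> (\<integral>\<^sup>+c. indicator G c * indicator (ball 0 r) (z - c) \<partial>lborel) * ?N z"
      using inner[of z] by (cases "z \<in> ball 0 R") (auto intro: mult_right_mono)
  qed
  also have "\<dots> = (\<integral>\<^sup>+z. (\<integral>\<^sup>+c. indicator G c * indicator (ball 0 r) (z - c) * ?N z \<partial>lborel) \<partial>lborel)"
    by (intro nn_integral_cong nn_integral_multc[symmetric]) measurable
  also have "\<dots> = (\<integral>\<^sup>+c. (\<integral>\<^sup>+z. indicator G c * indicator (ball 0 r) (z - c) * ?N z \<partial>lborel) \<partial>lborel)"
    by (rule lborel_pair.Fubini') measurable
  also have "\<dots> = (\<integral>\<^sup>+c. indicator G c * (\<integral>\<^sup>+z. indicator (ball 0 r) (z - c) * ?N z \<partial>lborel) \<partial>lborel)"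
    unfolding mult.assoc by (intro nn_integral_cong nn_integral_cmult) measurable
  also note outer
  finally have "disc_area r / 2 * (LINT z:ball 0 R|lborel. max 0 (- ?L z)) \<le> disc_area (R + 1) * Jp + n * t"
    by (subst (asm) ennreal_le_iff) (use Jp0 integral_disc_excess_pos[OF r(1)] in \<open>auto simp: t_def\<close>)
  also have "\<dots> \<le> disc_area (R + 1) * Jp + n * (disc_area r * r * inv_ball_const)"
    using integral_disc_excess_le[OF r] by (intro add_left_mono mult_left_mono) (auto simp: t_def)
  finally show ?thesis
    using disc_area_pos[OF r(1)] by (simp add: Jp_def field_simps)
qed

section \<open>Anticoncentration of independent sums\<close>

text \<open>Equality case of the triangle inequality: after rotating \<open>char M t\<close> to
  \<open>1\<close>, the nonnegative function \<open>1 - cos (t x - \<alpha>)\<close> has integral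
  zero and so vanishes almost everywhere.\<close>

lemma (in real_distribution) cmod_char_eq_1_imp:
  assumes "cmod (char M t) = 1"
  obtains \<alpha> where "AE x in M. cos (t * x - \<alpha>) = 1"
proof -
  obtain \<alpha> where \<alpha>: "char M t = cis \<alpha>"
    using assms by (metis cis_Arg_unique complex_norm_eq_1_exp norm_zero zero_neq_one is_Arg_def cis_conv_exp)
  have "(CLINT x|M. iexp (t * x) * cis (- \<alpha>)) = char M t * cis (- \<alpha>)"
    unfolding char_def by simp
  also have "\<dots> = 1" by (simp add: \<alpha> cis_mult)
  finally have "Re (CLINT x|M. iexp (t * x) * cis (- \<alpha>)) = 1" by simp
  moreover have int: "complex_integrable M (\<lambda>x. iexp (t * x) * cis (- \<alpha>))"
    by (intro integrable_mult_left integrable_iexp) auto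
  ultimately have 1: "(LINT x|M. Re (iexp (t * x) * cis (- \<alpha>))) = 1" by (metis integral_Re)
  have Re: "Re (iexp (t * x) * cis (- \<alpha>)) = cos (t * x - \<alpha>)" for x
    unfolding cis_conv_exp[symmetric] cis_mult by simp
  have intc: "integrable M (\<lambda>x. cos (t * x - \<alpha>))"
    by (rule integrable_const_bound[of _ 1]) auto
  have "(LINT x|M. 1 - cos (t * x - \<alpha>)) = 0"
    using 1 intc prob_space unfolding Re by simp
  hence "AE x in M. 1 - cos (t * x - \<alpha>) = 0"
    using intc by (subst (asm) integral_nonneg_eq_0_iff_AE) auto
  thus ?thesis by (intro that[of \<alpha>]) auto
qed

lemma countable_cos_eq_1:
  assumes "t \<noteq> 0"
  shows "countable {x :: real. cos (t * x - \<alpha>) = 1}"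
proof (rule countable_subset)
  show "{x. cos (t * x - \<alpha>) = 1} \<subseteq> range (\<lambda>k::int. (k * 2 * pi + \<alpha>) / t)"
  proof
    fix x assume "x \<in> {x. cos (t * x - \<alpha>) = 1}"
    then obtain k :: int where "t * x - \<alpha> = k * 2 * pi" by (auto simp: cos_one_2pi_int)
    hence "x = (k * 2 * pi + \<alpha>) / t" using assms by (simp add: field_simps)
    thus "x \<in> range (\<lambda>k::int. (k * 2 * pi + \<alpha>) / t)" by (intro range_eqI[of _ _ k]) simp
  qed
qed simp

text \<open>If some \<open>t0 \<noteq> 0\<close> gives modulus one, the measure lives on a countable
  lattice, and not being a point mass it has two atoms \<open>x1 \<noteq> x2\<close>. Every other
  such \<open>t\<close> then makes \<open>t * (x1 - x2)\<close> a multiple of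
  \<open>2 * pi\<close>.\<close>

lemma (in real_distribution) countable_cmod_char_eq_1:
  assumes nondeg: "\<And>y. \<not> (AE x in M. x = y)"
  shows "countable {t. cmod (char M t) = 1}"
proof (cases "\<exists>t. t \<noteq> 0 \<and> cmod (char M t) = 1")
  case False
  hence "{t. cmod (char M t) = 1} \<subseteq> {0}" by auto
  thus ?thesis using countable_subset by blast
next
  case True
  then obtain t0 where t0: "t0 \<noteq> 0" "cmod (char M t0) = 1" by blast
  obtain \<alpha>0 where a0: "AE x in M. cos (t0 * x - \<alpha>0) = 1" using cmod_char_eq_1_imp[OF t0(2)] .
  define L where "L = {x. cos (t0 * x - \<alpha>0) = 1}"
  have L: "countable L" "AE x in M. x \<in> L"
    using countable_cos_eq_1[OF t0(1)] a0 by (auto simp: L_def)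
  have null: "AE x in M. x \<notin> K" if "K \<subseteq> L" "\<And>x. x \<in> K \<Longrightarrow> emeasure M {x} = 0" for K
  proof -
    have "(\<Union>x\<in>K. {x}) \<in> null_sets M"
      using that countable_subset[OF that(1) L(1)] by (intro null_sets_UN') (auto intro: null_setsI)
    thus ?thesis using AE_not_in by fastforce
  qed
  obtain x1 where x1: "x1 \<in> L" "emeasure M {x1} \<noteq> 0"
  proof (rule ccontr)
    assume "\<not> thesis"
    hence "AE x in M. x \<notin> L" using that by (intro null) auto
    hence "AE x in M. False" using L(2) by eventually_elim auto
    thus False by simp
  qed
  obtain x2 where x2: "x2 \<in> L" "x2 \<noteq> x1" "emeasure M {x2} \<noteq> 0"
  proof (rule ccontr)
    assume "\<not> thesis"
    hence "AE x in M. x \<notin> L - {x1}" using that by (intro null) auto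
    hence "AE x in M. x = x1" using L(2) by eventually_elim auto
    thus False using nondeg by blast
  qed
  \<comment> \<open>An atom satisfies every property that holds almost everywhere.\<close>
  have atom: "P x" if "AE x in M. P x" "emeasure M {x} \<noteq> 0" for P x
  proof (rule ccontr)
    assume "\<not> P x"
    hence "AE y in M. y \<notin> {x}" using that(1) by (auto elim: eventually_mono)
    hence "{x} \<in> null_sets M" by (subst AE_iff_null_sets) auto
    thus False using that(2) by auto
  qed
  have "{t. cmod (char M t) = 1} \<subseteq> {t. cos ((x1 - x2) * t - 0) = 1}"
  proof safe
    fix t assume "cmod (char M t) = 1"
    then obtain \<alpha> where a: "AE x in M. cos (t * x - \<alpha>) = 1" using cmod_char_eq_1_imp by blast
    obtain k1 :: int where k1: "t * x1 - \<alpha> = k1 * 2 * pi"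
      using atom[OF a x1(2)] by (auto simp: cos_one_2pi_int)
    obtain k2 :: int where k2: "t * x2 - \<alpha> = k2 * 2 * pi"
      using atom[OF a x2(3)] by (auto simp: cos_one_2pi_int)
    have "(x1 - x2) * t - 0 = of_int (k1 - k2) * 2 * pi" using k1 k2 by (simp add: algebra_simps)
    thus "cos ((x1 - x2) * t - 0) = 1" unfolding cos_one_2pi_int by blast
  qed
  moreover have "countable {t. cos ((x1 - x2) * t - 0) = 1}"
    using x2 by (intro countable_cos_eq_1) auto
  ultimately show ?thesis by (rule countable_subset)
qed

section \<open>Small-ball probabilities of sums\<close>

text \<open>Gaussian smoothing: the indicator of \<open>|W| < 1\<close> is at most
  \<open>exp (1/2) * exp (- W^2 / 2)\<close>, and \<open>exp (- W^2 / 2)\<close> is the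
  characteristic function of the standard normal law at \<open>W\<close>. Fubini turns its mean into
  a normal average of the characteristic function of \<open>W\<close>, which factors by
  independence; the shift \<open>b\<close> contributes only a factor of modulus one.\<close>

lemma (in prob_space) prob_abs_less_1_le:
  fixes Y :: "nat \<Rightarrow> 'a \<Rightarrow> real"
  assumes indep: "indep_vars (\<lambda>_. borel) Y UNIV"
    and distr: "\<And>i. distr M borel (Y i) = \<nu>"
  shows "prob {\<omega> \<in> space M. \<bar>(\<Sum>i<m. Y i \<omega>) + b\<bar> < 1}
     \<le> exp (1/2) * (LINT t|std_normal_distribution. cmod (char \<nu> t) ^ m)"
proof -
  interpret N: real_distribution std_normal_distribution by (rule real_dist_normal_dist)
  have [measurable]: "Y i \<in> borel_measurable M" for i
    using indep by (auto simp: indep_vars_def)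
  define W where "W = (\<lambda>\<omega>. (\<Sum>i<m. Y i \<omega>) + b)"
  have W [measurable]: "W \<in> borel_measurable M" unfolding W_def by measurable
  have intW: "integrable M (\<lambda>\<omega>. exp (- (W \<omega>)\<^sup>2 / 2))"
    by (rule integrable_const_bound[of _ 1]) auto
  have "prob {\<omega> \<in> space M. \<bar>W \<omega>\<bar> < 1} = (LINT \<omega>|M. indicat_real {\<omega> \<in> space M. \<bar>W \<omega>\<bar> < 1} \<omega>)"
    by simp
  also have "\<dots> \<le> (LINT \<omega>|M. exp (1/2) * exp (- (W \<omega>)\<^sup>2 / 2))"
  proof (rule integral_mono)
    fix \<omega> assume "\<omega> \<in> space M"
    show "indicat_real {\<omega> \<in> space M. \<bar>W \<omega>\<bar> < 1} \<omega> \<le> exp (1/2) * exp (- (W \<omega>)\<^sup>2 / 2)"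
    proof (cases "\<bar>W \<omega>\<bar> < 1")
      case True
      hence "(W \<omega>)\<^sup>2 \<le> 1" by (simp add: abs_square_le_1)
      thus ?thesis by (auto simp: indicator_def exp_add[symmetric])
    qed auto
  qed (use intW in \<open>auto simp: emeasure_eq_measure\<close>)
  also have "\<dots> = exp (1/2) * (LINT \<omega>|M. exp (- (W \<omega>)\<^sup>2 / 2))" by simp
  also have "(LINT \<omega>|M. exp (- (W \<omega>)\<^sup>2 / 2)) \<le> (LINT t|std_normal_distribution. cmod (char \<nu> t) ^ m)"
  proof -
    interpret P: pair_prob_space M std_normal_distribution ..
    have int: "integrable (M \<Otimes>\<^sub>M std_normal_distribution) (\<lambda>(\<omega>, t). iexp (W \<omega> * t))"
      by (rule P.integrable_const_bound[of _ 1]) (auto simp: case_prod_beta)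
    have charW: "(CLINT \<omega>|M. iexp (W \<omega> * t)) = iexp (t * b) * (char \<nu> t) ^ m" for t
    proof -
      have "(CLINT \<omega>|M. iexp (W \<omega> * t)) = (CLINT \<omega>|M. iexp (t * b) * iexp (t * (\<Sum>i<m. Y i \<omega>)))"
        by (simp add: W_def exp_add[symmetric] algebra_simps)
      also have "\<dots> = iexp (t * b) * (CLINT \<omega>|M. iexp (t * (\<Sum>i<m. Y i \<omega>)))" by simp
      also have "(CLINT \<omega>|M. iexp (t * (\<Sum>i<m. Y i \<omega>))) = char (distr M borel (\<lambda>\<omega>. \<Sum>i<m. Y i \<omega>)) t"
        unfolding char_def by (subst integral_distr) auto
      also have "\<dots> = (\<Prod>i<m. char (distr M borel (Y i)) t)"
        by (rule char_distr_sum) (rule indep_vars_subset[OF indep], simp)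
      also have "\<dots> = (char \<nu> t) ^ m" by (simp add: distr)
      finally show ?thesis .
    qed
    have "complex_of_real (LINT \<omega>|M. exp (- (W \<omega>)\<^sup>2 / 2)) = (CLINT \<omega>|M. char std_normal_distribution (W \<omega>))"
      unfolding char_std_normal_distribution by (rule integral_complex_of_real[symmetric])
    also have "\<dots> = (CLINT \<omega>|M. CLINT t|std_normal_distribution. iexp (W \<omega> * t))"
      by (simp add: char_def)
    also have "\<dots> = (CLINT t|std_normal_distribution. CLINT \<omega>|M. iexp (W \<omega> * t))"
      by (rule P.Fubini_integral[OF int, symmetric])
    finally have "\<bar>LINT \<omega>|M. exp (- (W \<omega>)\<^sup>2 / 2)\<bar> = cmod (CLINT t|std_normal_distribution. CLINT \<omega>|M. iexp (W \<omega> * t))"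
      by (metis norm_of_real)
    also have "\<dots> \<le> (LINT t|std_normal_distribution. cmod (CLINT \<omega>|M. iexp (W \<omega> * t)))"
      by (rule integral_norm_bound)
    also have "\<dots> = (LINT t|std_normal_distribution. cmod (char \<nu> t) ^ m)"
      by (simp add: charW norm_mult norm_power del: of_real_mult)
    finally show ?thesis by simp
  qed
  finally show ?thesis by (simp add: W_def)
qed

text \<open>Off a countable set, which the normal law does not charge,
  \<open>|char \<nu> t| < 1\<close>, so the smoothed bound tends to zero by dominated convergence.
  That bound is independent of the shifts \<open>b n\<close>, which may therefore be
  arbitrary.\<close>

lemma (in prob_space) prob_iid_sum_small_tendsto_0:
  fixes Y :: "nat \<Rightarrow> 'a \<Rightarrow> real"
  assumes indep: "indep_vars (\<lambda>_. borel) Y UNIV"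
    and distr: "\<And>i. distr M borel (Y i) = \<nu>"
    and nondeg: "\<And>y. \<not> (AE x in \<nu>. x = y)"
    and m: "filterlim m at_top sequentially"
  shows "(\<lambda>n. prob {\<omega> \<in> space M. \<bar>(\<Sum>i<m n. Y i \<omega>) + b n\<bar> < 1}) \<longlonglongrightarrow> 0"
proof -
  interpret N: real_distribution std_normal_distribution by (rule real_dist_normal_dist)
  have Ym [measurable]: "Y i \<in> borel_measurable M" for i
    using indep by (auto simp: indep_vars_def)
  interpret R: real_distribution \<nu>
    using real_distribution_distr[of "Y 0"] by (simp add: distr)
  have ae: "AE t in std_normal_distribution. t \<notin> {t. cmod (char \<nu> t) = 1}"
  proof -
    have "{t. cmod (char \<nu> t) = 1} \<in> null_sets lborel"
      using R.countable_cmod_char_eq_1[OF nondeg] by (rule countable_imp_null_set_lborel)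
    hence "AE t in lborel. t \<notin> {t. cmod (char \<nu> t) = 1}" by (rule AE_not_in)
    thus ?thesis by (subst AE_density) (auto elim: eventually_mono)
  qed
  have "(\<lambda>n. LINT t|std_normal_distribution. cmod (char \<nu> t) ^ m n) \<longlonglongrightarrow> (LINT t|std_normal_distribution. 0)"
  proof (rule integral_dominated_convergence[where w = "\<lambda>_. 1"])
    show "AE t in std_normal_distribution. (\<lambda>n. cmod (char \<nu> t) ^ m n) \<longlonglongrightarrow> 0"
      using ae
    proof eventually_elim
      case (elim t)
      hence "cmod (char \<nu> t) < 1" using R.cmod_char_le_1[of t] by auto
      hence "(\<lambda>k. cmod (char \<nu> t) ^ k) \<longlonglongrightarrow> 0" by (intro LIMSEQ_power_zero) simp
      thus ?case using m by (rule filterlim_compose)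
    qed
    show "AE t in std_normal_distribution. norm (cmod (char \<nu> t) ^ m n) \<le> 1" for n
      using R.cmod_char_le_1 by (intro AE_I2) (simp add: power_le_one)
    show "(\<lambda>t. cmod (char \<nu> t) ^ m n) \<in> borel_measurable std_normal_distribution" for n
      using borel_measurable_continuous_onI[of "char \<nu>"] R.isCont_char
      by (auto simp: continuous_at_imp_continuous_on)
  qed auto
  hence lim: "(\<lambda>n. exp (1/2) * (LINT t|std_normal_distribution. cmod (char \<nu> t) ^ m n)) \<longlonglongrightarrow> 0"
    using tendsto_mult_right_zero by fastforce
  show ?thesis
  proof (rule tendsto_sandwich[OF _ _ tendsto_const lim])
    show "\<forall>\<^sub>F n in sequentially. prob {\<omega> \<in> space M. \<bar>(\<Sum>i<m n. Y i \<omega>) + b n\<bar> < 1}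
        \<le> exp (1/2) * (LINT t|std_normal_distribution. cmod (char \<nu> t) ^ m n)"
      using prob_abs_less_1_le[OF indep distr] by (intro always_eventually allI)
  qed auto
qed

text \<open>Modulus below 1 forces both coordinates below 1 in absolute value, so it suffices that
  one coordinate of \<open>inverse (c - x)\<close> is not almost everywhere constant. If both were
  constant, \<open>\<mu>\<close> would be a point mass.\<close>

lemma (in prob_space) prob_iid_complex_sum_small_tendsto_0:
  fixes X :: "nat \<Rightarrow> 'a \<Rightarrow> complex" and c :: complex
  assumes Xm: "\<And>i. X i \<in> borel_measurable M"
    and indep: "indep_vars (\<lambda>_. borel) X UNIV"
    and distr: "\<And>i. distr M borel (X i) = \<mu>"
    and nondeg: "\<And>y. \<not> (AE x in \<mu>. x = y)"
    and m: "filterlim m at_top sequentially"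
  shows "(\<lambda>n. prob {\<omega> \<in> space M. cmod ((\<Sum>i<m n. inverse (c - X i \<omega>)) + b n) < 1}) \<longlonglongrightarrow> 0"
proof -
  note [measurable] = Xm
  have sets: "sets \<mu> = sets borel" using distr[of 0] by auto
  have main: ?thesis
    if P: "P = Re \<or> P = Im" and nd: "\<And>y. \<not> (AE x in \<mu>. P (inverse (c - x)) = y)" for P :: "complex \<Rightarrow> real"
  proof -
    have Pm [measurable]: "P \<in> borel_measurable borel" using P by auto
    have Padd: "P (x + y) = P x + P y" for x y using P by auto
    have P0: "P 0 = 0" using P by auto
    have Psum: "P (sum f A) = (\<Sum>i\<in>A. P (f i))" for f :: "nat \<Rightarrow> complex" and A
      by (induction A rule: infinite_finite_induct) (auto simp: Padd P0)
    have Ple: "\<bar>P z\<bar> \<le> cmod z" for z using P abs_Re_le_cmod abs_Im_le_cmod by auto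
    define Y where "Y = (\<lambda>i \<omega>. P (inverse (c - X i \<omega>)))"
    have "(\<lambda>n. prob {\<omega> \<in> space M. \<bar>(\<Sum>i<m n. Y i \<omega>) + P (b n)\<bar> < 1}) \<longlonglongrightarrow> 0"
    proof (rule prob_iid_sum_small_tendsto_0[OF _ _ _ m])
      show "indep_vars (\<lambda>_. borel) Y UNIV"
        unfolding Y_def by (rule indep_vars_compose2[OF indep]) measurable
      show "distr M borel (Y i) = distr \<mu> borel (\<lambda>x. P (inverse (c - x)))" for i
        unfolding distr[of i, symmetric] Y_def by (subst distr_distr) (auto simp: o_def)
      show "\<not> (AE x in distr \<mu> borel (\<lambda>x. P (inverse (c - x))). x = y)" for y
        using nd[of y] by (subst AE_distr_iff) (auto simp: measurable_cong_sets[OF sets refl])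
    qed
    note lim = this
    show ?thesis
    proof (rule tendsto_sandwich[OF _ _ tendsto_const lim])
      show "\<forall>\<^sub>F n in sequentially. prob {\<omega> \<in> space M. cmod ((\<Sum>i<m n. inverse (c - X i \<omega>)) + b n) < 1}
          \<le> prob {\<omega> \<in> space M. \<bar>(\<Sum>i<m n. Y i \<omega>) + P (b n)\<bar> < 1}"
      proof (intro always_eventually allI finite_measure_mono)
        fix n
        show "{\<omega> \<in> space M. cmod ((\<Sum>i<m n. inverse (c - X i \<omega>)) + b n) < 1}
            \<subseteq> {\<omega> \<in> space M. \<bar>(\<Sum>i<m n. Y i \<omega>) + P (b n)\<bar> < 1}"
        proof safe
          fix \<omega> assume "cmod ((\<Sum>i<m n. inverse (c - X i \<omega>)) + b n) < 1"
          thus "\<bar>(\<Sum>i<m n. Y i \<omega>) + P (b n)\<bar> < 1"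
            using Ple[of "(\<Sum>i<m n. inverse (c - X i \<omega>)) + b n"]
            unfolding Y_def Padd Psum by linarith
        qed
        show "{\<omega> \<in> space M. \<bar>(\<Sum>i<m n. Y i \<omega>) + P (b n)\<bar> < 1} \<in> events"
          unfolding Y_def by measurable
      qed
    qed auto
  qed
  show ?thesis
  proof (cases "\<exists>y. AE x in \<mu>. Re (inverse (c - x)) = y")
    case False
    thus ?thesis using main[of Re] by auto
  next
    case True
    then obtain y1 where y1: "AE x in \<mu>. Re (inverse (c - x)) = y1" by blast
    have "\<not> (AE x in \<mu>. Im (inverse (c - x)) = y2)" for y2
    proof
      assume "AE x in \<mu>. Im (inverse (c - x)) = y2"
      with y1 have "AE x in \<mu>. x = c - inverse (Complex y1 y2)"
      proof eventually_elim
        case (elim x)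
        hence "inverse (c - x) = Complex y1 y2" by (simp add: complex_eq_iff)
        \<comment> \<open>With \<open>inverse 0 = 0\<close>, inversion is an involution on all of
          \<open>complex\<close>, so \<open>x = c\<close> is no exception.\<close>
        hence "c - x = inverse (Complex y1 y2)" by (metis inverse_inverse_eq)
        thus ?case by (simp add: algebra_simps)
      qed
      thus False using nondeg by blast
    qed
    thus ?thesis using main[of Im] by auto
  qed
qed

section \<open>Deterministic comparison of zeros and critical points\<close>

text \<open>The only term linear in \<open>n\<close> carries the factor \<open>r\<close>, so a small
  fixed \<open>r\<close> makes it at most half of the target; the other terms are of order
  \<open>ln n\<close>. Half the area of the disc of radius \<open>r\<close> serves as
  \<open>\<delta>\<close>. Uniformity in \<open>a\<close> is what later permits random
  zeros.\<close>

lemma integral_abs_log_deriv_small: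
  fixes R \<eta> :: real
  assumes \<eta>: "\<eta> > 0"
  obtains \<delta> where "\<delta> > 0"
    "\<forall>\<^sub>F n in sequentially. \<forall>a. measure lborel {c \<in> ball 0 (R + 1). cmod (pole_sum a n c) < 1} \<le> \<delta> \<longrightarrow>
       (LINT z:ball 0 R|lborel. \<bar>log_deriv a n z\<bar>) \<le> \<eta> * real n"
proof -
  define K where "K = inv_ball_const"
  have K0: "K \<ge> 0" by (simp add: K_def inv_ball_const_nonneg)
  \<comment> \<open>Chosen to make \<open>2 * r * K \<le> \<eta> / 2\<close>; the \<open>+ 1\<close>
    keeps the denominator positive.\<close>
  define r where "r = min 1 (\<eta> / (4 * (K + 1)))"
  have r: "0 < r" "r \<le> 1" using \<eta> K0 by (auto simp: r_def)
  have rK: "2 * r * K \<le> \<eta> / 2"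
  proof -
    have "r \<le> \<eta> / (4 * (K + 1))" by (simp add: r_def)
    hence "r * (4 * (K + 1)) \<le> \<eta>" using K0 by (simp add: pos_le_divide_eq)
    thus ?thesis using r by (simp add: algebra_simps)
  qed
  define C where "C = 2 * disc_area (R + 1) / disc_area r"
  have C0: "C \<ge> 0" by (simp add: C_def)
  define A where "A = disc_area (R + 2)"
  define A' where "A' = disc_area R"
  have "(\<lambda>n. (A' * ln (real n) + (K + A') + C * (A * ln (real n) + (K + A))) / real n) \<longlonglongrightarrow> 0"
  proof -
    have l: "(\<lambda>n. ln (real n) / real n) \<longlonglongrightarrow> 0"
      using lim_ln_over_n .
    have i: "(\<lambda>n. 1 / real n) \<longlonglongrightarrow> 0" by (rule lim_1_over_n)
    have "(\<lambda>n. (A' + C * A) * (ln (real n) / real n) + (K + A' + C * (K + A)) * (1 / real n)) \<longlonglongrightarrow>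
        (A' + C * A) * 0 + (K + A' + C * (K + A)) * 0"
      by (intro tendsto_intros l i)
    thus ?thesis by (simp add: field_simps add_divide_distrib)
  qed
  hence "\<forall>\<^sub>F n in sequentially. (A' * ln (real n) + (K + A') + C * (A * ln (real n) + (K + A))) / real n < \<eta> / 2"
    by (rule order_tendstoD) (use \<eta> in simp)
  hence ev: "\<forall>\<^sub>F n in sequentially. \<forall>a. measure lborel {c \<in> ball 0 (R + 1). cmod (pole_sum a n c) < 1} \<le> disc_area r / 2 \<longrightarrow>
       (LINT z:ball 0 R|lborel. \<bar>log_deriv a n z\<bar>) \<le> \<eta> * real n"
    using eventually_gt_at_top[of 0]
  proof eventually_elim
    case (elim n)
    have le: "A' * ln (real n) + (K + A') + C * (A * ln (real n) + (K + A)) \<le> \<eta> / 2 * n"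
      using elim by (simp add: field_simps)
    show ?case
    proof safe
      fix a assume small: "measure lborel {c \<in> ball 0 (R + 1). cmod (pole_sum a n c) < 1} \<le> disc_area r / 2"
      have i: "set_integrable lborel (ball 0 R) (log_deriv a n)"
        "set_integrable lborel (ball 0 R) (\<lambda>z. - log_deriv a n z)"
        using set_integrable_log_deriv[OF elim(2), of 0 R a] by (auto simp: set_integrable_def)
      have "(LINT z:ball 0 R|lborel. \<bar>log_deriv a n z\<bar>) = (LINT z:ball 0 R|lborel. max 0 (log_deriv a n z) + max 0 (- log_deriv a n z))"
        by (intro arg_cong[where f = "set_lebesgue_integral _ _"] ext) auto
      also have "\<dots> = (LINT z:ball 0 R|lborel. max 0 (log_deriv a n z)) + (LINT z:ball 0 R|lborel. max 0 (- log_deriv a n z))"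
        using i by (intro set_integral_add set_integrable_pos_part)
      also have "(LINT z:ball 0 R|lborel. max 0 (log_deriv a n z)) \<le> A' * ln (real n) + (K + A')"
        unfolding A'_def K_def by (rule integral_log_deriv_pos_le[OF elim(2)])
      also have "(LINT z:ball 0 R|lborel. max 0 (- log_deriv a n z)) \<le>
          2 * real n * r * K + C * (LINT z:ball 0 (R + 2)|lborel. max 0 (log_deriv a n z))"
        unfolding C_def K_def by (rule integral_log_deriv_neg_le[OF elim(2) r small])
      also have "(LINT z:ball 0 (R + 2)|lborel. max 0 (log_deriv a n z)) \<le> A * ln (real n) + (K + A)"
        unfolding A_def K_def by (rule integral_log_deriv_pos_le[OF elim(2)])
      finally have "(LINT z:ball 0 R|lborel. \<bar>log_deriv a n z\<bar>) \<le>
          2 * real n * r * K + (A' * ln (real n) + (K + A') + C * (A * ln (real n) + (K + A)))"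
        using C0 by (simp add: mult_left_mono)
      also have "\<dots> \<le> 2 * real n * r * K + \<eta> / 2 * n" using le by simp
      also have "2 * real n * r * K = (2 * r * K) * n" by simp
      also have "(2 * r * K) * n \<le> \<eta> / 2 * n" using rK by (intro mult_right_mono) auto
      finally show "(LINT z:ball 0 R|lborel. \<bar>log_deriv a n z\<bar>) \<le> \<eta> * real n" by simp
    qed
  qed
  show ?thesis by (rule that[OF _ ev]) (use disc_area_pos[OF r(1)] in simp)
qed

lemma compactly_supported_uniform:
  fixes f :: "complex \<Rightarrow> real" and e :: real
  assumes f: "continuous_on UNIV f" and supp: "\<And>z. cmod z \<ge> R \<Longrightarrow> f z = 0" and e: "e > 0"
  shows "\<exists>r>0. \<forall>x y. dist x y < r \<longrightarrow> \<bar>f x - f y\<bar> \<le> e"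
proof -
  have "uniformly_continuous_on (cball 0 (R + 1)) f"
    by (rule compact_uniformly_continuous[OF continuous_on_subset[OF f]]) auto
  then obtain d where d: "d > 0" "\<And>x y. x \<in> cball 0 (R + 1) \<Longrightarrow> y \<in> cball 0 (R + 1) \<Longrightarrow> dist x y < d \<Longrightarrow> dist (f x) (f y) < e"
    using e unfolding uniformly_continuous_on_def by (metis dist_commute)
  show ?thesis
  proof (intro exI[of _ "min d 1"] conjI allI impI)
    fix x y :: complex assume xy: "dist x y < min d 1"
    show "\<bar>f x - f y\<bar> \<le> e"
    proof (cases "x \<in> cball 0 (R + 1) \<and> y \<in> cball 0 (R + 1)")
      case True
      thus ?thesis using d(2)[of x y] xy by (simp add: dist_real_def)
    next
      case False
      \<comment> \<open>Since the points are less than 1 apart, one of them outside the disc of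
        radius \<open>R + 1\<close> forces both to modulus at least \<open>R\<close>, where
        \<open>f\<close> vanishes.\<close>
      have "\<bar>cmod x - cmod y\<bar> < 1" using xy norm_triangle_ineq3[of x y] by (simp add: dist_norm)
      hence "cmod x \<ge> R" "cmod y \<ge> R" using False by auto
      thus ?thesis using supp e by simp
    qed
  qed (use d in auto)
qed

text \<open>Half of the error pays for smoothing \<open>f\<close>, at a price of
  \<open>e / 4\<close> for each of at most \<open>2 * n\<close> zeros and critical points. The other
  half pays for the \<open>L^1\<close> norm of \<open>log_deriv\<close>, and \<open>\<eta>\<close>
  is chosen to make that norm small relative to the mass \<open>t\<close> of the excess.\<close>

lemma critical_points_close:
  fixes f :: "complex \<Rightarrow> real" and e :: real
  assumes f: "continuous_on UNIV f" and B: "\<And>z. \<bar>f z\<bar> \<le> B"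
    and supp: "\<And>z. cmod z \<ge> R \<Longrightarrow> f z = 0" and e: "e > 0"
  obtains R' \<delta> where "\<delta> > 0"
    "\<forall>\<^sub>F n in sequentially. \<forall>a. measure lborel {c \<in> ball 0 R'. cmod (pole_sum a n c) < 1} \<le> \<delta> \<longrightarrow>
       \<bar>(\<Sum>w\<in>#proots (pderiv (monic_poly a n)). f w) - (\<Sum>i<n. f (a i))\<bar> \<le> e * real n"
proof -
  obtain r where r: "r > 0" and uc: "\<And>x y. dist x y < r \<Longrightarrow> \<bar>f x - f y\<bar> \<le> e / 4"
    using compactly_supported_uniform[OF f supp, where R = R and e = "e / 4"] e by auto
  define t where "t = (LINT v|lborel. disc_excess r v)"
  have t: "t > 0" unfolding t_def by (rule integral_disc_excess_pos[OF r])
  define C where "C = B * (disc_area R + disc_area r)"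
  have C0: "C \<ge> 0" using B[of 0] by (auto simp: C_def intro!: mult_nonneg_nonneg)
  define \<eta> where "\<eta> = e * t / (2 * (C + 1))"
  have \<eta>: "\<eta> > 0" using e t C0 by (auto simp: \<eta>_def)
  have C\<eta>: "C * \<eta> \<le> e * t / 2"
  proof -
    have "C * \<eta> \<le> (C + 1) * \<eta>" using \<eta> by (intro mult_right_mono) auto
    also have "\<dots> = e * t / 2" using C0 by (simp add: \<eta>_def field_simps)
    finally show ?thesis .
  qed
  obtain \<delta> where \<delta>: "\<delta> > 0" and ev:
    "\<forall>\<^sub>F n in sequentially. \<forall>a. measure lborel {c \<in> ball 0 (R + r + 1). cmod (pole_sum a n c) < 1} \<le> \<delta> \<longrightarrow>
       (LINT z:ball 0 (R + r)|lborel. \<bar>log_deriv a n z\<bar>) \<le> \<eta> * real n"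
    using integral_abs_log_deriv_small[OF \<eta>, of "R + r"] by blast
  have "\<forall>\<^sub>F n in sequentially. \<forall>a. measure lborel {c \<in> ball 0 (R + r + 1). cmod (pole_sum a n c) < 1} \<le> \<delta> \<longrightarrow>
       \<bar>(\<Sum>w\<in>#proots (pderiv (monic_poly a n)). f w) - (\<Sum>i<n. f (a i))\<bar> \<le> e * real n"
    using ev eventually_gt_at_top[of 0]
  proof eventually_elim
    case (elim n)
    show ?case
    proof safe
      fix a assume "measure lborel {c \<in> ball 0 (R + r + 1). cmod (pole_sum a n c) < 1} \<le> \<delta>"
      hence J: "(LINT z:ball 0 (R + r)|lborel. \<bar>log_deriv a n z\<bar>) \<le> \<eta> * real n" using elim by blast
      let ?p = "monic_poly a n"
      let ?D = "\<bar>(\<Sum>w\<in>#proots (pderiv ?p). f w) - (\<Sum>w\<in>#proots ?p. f w)\<bar>"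
      have "?D * t \<le> C * (LINT z:ball 0 (R + r)|lborel. \<bar>log_deriv a n z\<bar>)
         + (degree (pderiv ?p) + degree ?p) * (e / 4 * t)"
        unfolding t_def C_def log_deriv_def
        by (rule sum_proots_diff_le[OF f B supp uc r]) (auto simp: pderiv_monic_poly_nonzero elim)
      also have "\<dots> \<le> C * (\<eta> * real n) + (2 * real n) * (e / 4 * t)"
        using J C0 e t by (intro add_mono mult_left_mono mult_right_mono) auto
      also have "C * (\<eta> * real n) \<le> e * t / 2 * n"
        using C\<eta> mult_right_mono[of "C * \<eta>" "e * t / 2" "real n"] by (simp add: mult.assoc)
      finally have "?D * t \<le> (e * real n) * t" by (simp add: algebra_simps)
      hence "?D \<le> e * real n" using t by simp
      moreover have "(\<Sum>w\<in>#proots ?p. f w) = (\<Sum>i<n. f (a i))"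
        by (simp add: proots_monic_poly sum_unfold_sum_mset image_mset.compositionality o_def)
      ultimately show "\<bar>(\<Sum>w\<in>#proots (pderiv ?p). f w) - (\<Sum>i<n. f (a i))\<bar> \<le> e * real n" by simp
    qed
  qed
  thus ?thesis using that \<delta> by blast
qed

section \<open>Critical points of the random polynomial\<close>

text \<open>The multiset form permits induction over the zeros. For \<open>q = 0\<close> both sides
  are \<open>0\<close>.\<close>

lemma zero_measure_integral_eq_proots:
  "zero_measure_integral q f = (\<Sum>w\<in>#proots q. f w) / degree q"
proof (cases "q = 0")
  case False
  have "(\<Sum>w\<in>#A. f w) = (\<Sum>w\<in>S. real (count A w) * f w)"
    if "finite S" "set_mset A \<subseteq> S" for A S
    using that(2)
  proof (induction A)
    case (add x A)
    have "(\<Sum>w\<in>S. real (count (add_mset x A) w) * f w)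
        = (\<Sum>w\<in>S. (if w = x then f w else 0) + real (count A w) * f w)"
      by (intro sum.cong) (auto simp: algebra_simps)
    also have "\<dots> = f x + (\<Sum>w\<in>S. real (count A w) * f w)"
      using add.prems that(1) by (simp add: sum.distrib)
    finally show ?case using add by simp
  qed simp
  from this[OF _ order_refl, of "proots q"] show ?thesis
    using False poly_roots_finite[OF False] by (simp add: zero_measure_integral_def)
qed (simp add: zero_measure_integral_def)

text \<open>Sampled and prescribed zeros merged into one sequence, so that the estimates for
  arbitrary zeros \<open>a\<close> apply to every outcome.\<close>

definition all_zeros :: "(nat \<Rightarrow> nat) \<Rightarrow> (nat \<Rightarrow> nat \<Rightarrow> complex) \<Rightarrow> (nat \<Rightarrow> complex) \<Rightarrow> nat \<Rightarrow> nat \<Rightarrow> complex" where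
  "all_zeros k \<xi> x n i = (if i < n - k n then x i else \<xi> n (i - (n - k n)))"

lemma
  fixes h :: "complex \<Rightarrow> 'b::comm_monoid_mult" and g :: "complex \<Rightarrow> 'c::comm_monoid_add"
  assumes "k n \<le> n"
  shows prod_all_zeros: "(\<Prod>i<n. h (all_zeros k \<xi> x n i)) = (\<Prod>j<n - k n. h (x j)) * (\<Prod>l<k n. h (\<xi> n l))"
    and sum_all_zeros: "(\<Sum>i<n. g (all_zeros k \<xi> x n i)) = (\<Sum>j<n - k n. g (x j)) + (\<Sum>l<k n. g (\<xi> n l))"
proof -
  have split: "{..<n} = {..<n - k n} \<union> (+) (n - k n) ` {..<k n}"
  proof (intro set_eqI iffI)
    fix i assume "i \<in> {..<n}"
    thus "i \<in> {..<n - k n} \<union> (+) (n - k n) ` {..<k n}"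
      using assms by (cases "i < n - k n") (auto intro!: image_eqI[of _ _ "i - (n - k n)"])
  qed (use assms in auto)
  have disj: "{..<n - k n} \<inter> (+) (n - k n) ` {..<k n} = {}" by auto
  show "(\<Prod>i<n. h (all_zeros k \<xi> x n i)) = (\<Prod>j<n - k n. h (x j)) * (\<Prod>l<k n. h (\<xi> n l))"
    unfolding split by (subst prod.union_disjoint) (auto simp: disj prod.reindex all_zeros_def)
  show "(\<Sum>i<n. g (all_zeros k \<xi> x n i)) = (\<Sum>j<n - k n. g (x j)) + (\<Sum>l<k n. g (\<xi> n l))"
    unfolding split by (subst sum.union_disjoint) (auto simp: disj sum.reindex all_zeros_def)
qed

lemma p_poly_eq_monic_poly: "k n \<le> n \<Longrightarrow> p_poly k \<xi> x n = monic_poly (all_zeros k \<xi> x n) n"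
  using prod_all_zeros[of k n "\<lambda>z. [:- z, 1:]" \<xi> x] by (simp add: p_poly_def monic_poly_def)

lemma pole_sum_all_zeros:
  "k n \<le> n \<Longrightarrow> pole_sum (all_zeros k \<xi> x n) n c = (\<Sum>j<n - k n. inverse (c - x j)) + (\<Sum>l<k n. inverse (c - \<xi> n l))"
  using sum_all_zeros[of k n "\<lambda>z. inverse (c - z)" \<xi> x] by (simp add: pole_sum_def)

section \<open>Convergence in probability\<close>

context prob_space
begin

text \<open>The events in question need not be measurable, so convergence in probability is expressed
  through measurable majorants.\<close>
definition vanishing :: "(nat \<Rightarrow> 'a set) \<Rightarrow> bool" where
  "vanishing A \<longleftrightarrow> (\<exists>B. (\<forall>n. B n \<in> events) \<and> (\<forall>\<^sub>F n in sequentially. A n \<subseteq> B n) \<and> (\<lambda>n. prob (B n)) \<longlonglongrightarrow> 0)"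

lemma vanishing_mono:
  assumes "vanishing B" "\<forall>\<^sub>F n in sequentially. A n \<subseteq> B n"
  shows "vanishing A"
proof -
  obtain C where C: "\<forall>n. C n \<in> events" "\<forall>\<^sub>F n in sequentially. B n \<subseteq> C n" "(\<lambda>n. prob (C n)) \<longlonglongrightarrow> 0"
    using assms(1) unfolding vanishing_def by blast
  have "\<forall>\<^sub>F n in sequentially. A n \<subseteq> C n"
    using assms(2) C(2) by eventually_elim blast
  thus ?thesis unfolding vanishing_def using C by blast
qed

lemma vanishing_Un:
  assumes "vanishing A" "vanishing B"
  shows "vanishing (\<lambda>n. A n \<union> B n)"
proof -
  obtain C where C: "\<forall>n. C n \<in> events" "\<forall>\<^sub>F n in sequentially. A n \<subseteq> C n" "(\<lambda>n. prob (C n)) \<longlonglongrightarrow> 0"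
    using assms(1) unfolding vanishing_def by blast
  obtain D where D: "\<forall>n. D n \<in> events" "\<forall>\<^sub>F n in sequentially. B n \<subseteq> D n" "(\<lambda>n. prob (D n)) \<longlonglongrightarrow> 0"
    using assms(2) unfolding vanishing_def by blast
  have lim: "(\<lambda>n. prob (C n) + prob (D n)) \<longlonglongrightarrow> 0"
    using tendsto_add[OF C(3) D(3)] by simp
  have "(\<lambda>n. prob (C n \<union> D n)) \<longlonglongrightarrow> 0"
    by (rule tendsto_sandwich[OF _ _ tendsto_const lim])
       (use C D in \<open>auto intro!: always_eventually measure_Un_le\<close>)
  moreover have "\<forall>\<^sub>F n in sequentially. A n \<union> B n \<subseteq> C n \<union> D n"
    using C(2) D(2) by eventually_elim blast
  ultimately show ?thesis unfolding vanishing_def using C D by (intro exI[of _ "\<lambda>n. C n \<union> D n"]) auto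
qed

text \<open>If \<open>A n\<close> is not measurable its \<open>prob\<close> is \<open>0\<close> by
  convention, so comparison with the measurable majorant holds in every case.\<close>

lemma vanishing_imp_tendsto: 
  assumes "vanishing A"
  shows "(\<lambda>n. prob (A n)) \<longlonglongrightarrow> 0"
proof -
  obtain C where C: "\<forall>n. C n \<in> events" "\<forall>\<^sub>F n in sequentially. A n \<subseteq> C n" "(\<lambda>n. prob (C n)) \<longlonglongrightarrow> 0"
    using assms unfolding vanishing_def by blast
  have "\<forall>\<^sub>F n in sequentially. prob (A n) \<le> prob (C n)"
    using C(2) by eventually_elim (use C(1) in \<open>auto intro: finite_measure_mono\<close>)
  thus ?thesis by (intro tendsto_sandwich[OF _ _ tendsto_const C(3)]) auto
qed

lemma vanishingI: "(\<And>n. A n \<in> events) \<Longrightarrow> (\<lambda>n. prob (A n)) \<longlonglongrightarrow> 0 \<Longrightarrow> vanishing A"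
  unfolding vanishing_def by (intro exI[of _ A]) auto

text \<open>A weak law of large numbers for the bounded variables \<open>f (X i)\<close>, from the
  exponential bound of Hoeffding's inequality.\<close>

lemma vanishing_sampled_mean:
  fixes X :: "nat \<Rightarrow> 'a \<Rightarrow> complex" and f :: "complex \<Rightarrow> real"
  assumes Xm: "\<And>i. X i \<in> borel_measurable M"
    and indep: "indep_vars (\<lambda>_. borel) X UNIV"
    and distr: "\<And>i. distr M borel (X i) = \<mu>"
    and fm: "f \<in> borel_measurable borel" and B: "\<And>z. \<bar>f z\<bar> \<le> B"
    and e: "e > 0"
  shows "vanishing (\<lambda>n. {\<omega> \<in> space M. \<bar>(\<Sum>i<n. f (X i \<omega>)) / n - integral\<^sup>L \<mu> f\<bar> \<ge> e})"
proof (rule vanishingI)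
  note [measurable] = Xm fm
  show "{\<omega> \<in> space M. \<bar>(\<Sum>i<n. f (X i \<omega>)) / n - integral\<^sup>L \<mu> f\<bar> \<ge> e} \<in> events" for n
    by measurable
  have B0: "B \<ge> 0" using B[of 0] by linarith
  have E: "expectation (\<lambda>\<omega>. f (X 0 \<omega>)) = integral\<^sup>L \<mu> f"
    unfolding distr[of 0, symmetric] by (subst integral_distr) auto
  have le: "prob {\<omega> \<in> space M. \<bar>(\<Sum>i<n. f (X i \<omega>)) / n - integral\<^sup>L \<mu> f\<bar> \<ge> e}
      \<le> 2 * exp (-2 * real n * e\<^sup>2 / (B + 1 - (- B))\<^sup>2)" if n: "n > 0" for n
  proof -
    \<comment> \<open>The upper end \<open>B + 1\<close> keeps the interval nondegenerate when
      \<open>B = 0\<close>.\<close>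
    interpret H: Hoeffding_ineq_iid M "{..<n}" "\<lambda>i \<omega>. f (X i \<omega>)" "\<lambda>\<omega>. f (X 0 \<omega>)" "-B" "B + 1" "expectation (\<lambda>\<omega>. f (X 0 \<omega>))"
    proof unfold_locales
      show "indep_vars (\<lambda>_. borel) (\<lambda>i \<omega>. f (X i \<omega>)) {..<n}"
        by (rule indep_vars_subset[OF indep_vars_compose2[OF indep]]) auto
      have "distr M borel (\<lambda>\<omega>. f (X i \<omega>)) = distr \<mu> borel f" for i
        unfolding distr[of i, symmetric] by (subst distr_distr) (auto simp: o_def)
      thus "distr M borel (\<lambda>\<omega>. f (X i \<omega>)) = distr M borel (\<lambda>\<omega>. f (X 0 \<omega>))" for i by simp
      show "AE \<omega> in M. f (X 0 \<omega>) \<in> {- B..B + 1}"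
        using B by (intro AE_I2) (smt (verit) atLeastAtMost_iff abs_le_iff)
    qed auto
    show ?thesis using H.Hoeffding_ineq_abs_ge'[of e] e B0 n by (auto simp: E)
  qed
  have lim: "(\<lambda>n. 2 * exp (-2 * real n * e\<^sup>2 / (B + 1 - (- B))\<^sup>2)) \<longlonglongrightarrow> 0"
  proof -
    define d where "d = 2 * e\<^sup>2 / (B + 1 - (- B))\<^sup>2"
    have d: "d > 0" using e B0 by (auto simp: d_def intro!: divide_pos_pos mult_pos_pos zero_less_power)
    have "(\<lambda>n. 2 * (exp (- d)) ^ n) \<longlonglongrightarrow> 2 * 0"
      using d by (intro tendsto_mult tendsto_const LIMSEQ_power_zero) auto
    moreover have "exp (-2 * real n * e\<^sup>2 / (B + 1 - (- B))\<^sup>2) = exp (- d) ^ n" for n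
      by (simp add: d_def exp_of_nat_mult[symmetric] mult_ac)
    ultimately show ?thesis by simp
  qed
  show "(\<lambda>n. prob {\<omega> \<in> space M. \<bar>(\<Sum>i<n. f (X i \<omega>)) / n - integral\<^sup>L \<mu> f\<bar> \<ge> e}) \<longlonglongrightarrow> 0"
  proof (rule tendsto_sandwich[OF _ _ tendsto_const lim])
    show "\<forall>\<^sub>F n in sequentially. prob {\<omega> \<in> space M. \<bar>(\<Sum>i<n. f (X i \<omega>)) / n - integral\<^sup>L \<mu> f\<bar> \<ge> e}
        \<le> 2 * exp (-2 * real n * e\<^sup>2 / (B + 1 - (- B))\<^sup>2)"
      using eventually_gt_at_top[of 0] by eventually_elim (rule le)
  qed auto
qed

text \<open>By Fubini the expected bad area is the integral over the disc of the probability that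
  \<open>|S c| < 1\<close>. This probability tends to zero at each centre, dominated convergence
  carries this to the expectation, and Markov's inequality concludes.\<close>

lemma vanishing_bad_centres:
  fixes X :: "nat \<Rightarrow> 'a \<Rightarrow> complex"
  assumes Xm: "\<And>i. X i \<in> borel_measurable M"
    and indep: "indep_vars (\<lambda>_. borel) X UNIV"
    and distr: "\<And>i. distr M borel (X i) = \<mu>"
    and nondeg: "\<And>y. \<not> (AE x in \<mu>. x = y)"
    and kn: "\<And>n. k n \<le> n" and m: "filterlim (\<lambda>n. n - k n) at_top sequentially"
    and \<delta>: "\<delta> > 0"
  shows "vanishing (\<lambda>n. {\<omega> \<in> space M. measure lborel {c \<in> ball 0 R. cmod (pole_sum (all_zeros k \<xi> (\<lambda>j. X j \<omega>) n) n c) < 1} \<ge> \<delta>})"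
proof -
  note [measurable] = Xm
  interpret P: pair_sigma_finite lborel M ..
  \<comment> \<open>The pole sum in the form required by anticoncentration: independent terms plus a
    shift that does not depend on \<open>\<omega>\<close>.\<close>
  define S where "S = (\<lambda>n \<omega> c. (\<Sum>j<n - k n. inverse (c - X j \<omega>)) + (\<Sum>l<k n. inverse (c - \<xi> n l)))"
  have Sm [measurable]: "(\<lambda>(c, \<omega>). S n \<omega> c) \<in> borel_measurable (lborel \<Otimes>\<^sub>M M)" for n
    unfolding S_def by measurable
  define g where "g = (\<lambda>n c \<omega>. indicat_real (ball 0 R) c * indicat_real {x. cmod x < 1} (S n \<omega> c))"
  have Im [measurable]: "{x::complex. cmod x < 1} \<in> sets borel" by measurable
  have gm [measurable]: "(\<lambda>(c, \<omega>). g n c \<omega>) \<in> borel_measurable (lborel \<Otimes>\<^sub>M M)" for n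
    unfolding g_def by measurable
  have gint: "integrable (lborel \<Otimes>\<^sub>M M) (\<lambda>(c, \<omega>). g n c \<omega>)" for n
  proof (rule Bochner_Integration.integrable_bound)
    have "emeasure (lborel \<Otimes>\<^sub>M M) (ball (0::complex) R \<times> space M) < \<infinity>"
      using emeasure_disc_finite[of 0 R] by (subst emeasure_pair_measure_Times) (auto simp: emeasure_space_1)
    thus "integrable (lborel \<Otimes>\<^sub>M M) (indicat_real (ball (0::complex) R \<times> space M))"
      by (intro integrable_real_indicator) auto
    show "AE x in lborel \<Otimes>\<^sub>M M. norm (case x of (c, \<omega>) \<Rightarrow> g n c \<omega>) \<le> norm (indicat_real (ball (0::complex) R \<times> space M) x)"
      by (intro AE_I2) (auto simp: g_def indicator_def space_pair_measure)
  qed measurable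
  define D where "D = (\<lambda>n \<omega>. LINT c|lborel. g n c \<omega>)"
  have D_eq: "D n \<omega> = measure lborel {c \<in> ball 0 R. cmod (pole_sum (all_zeros k \<xi> (\<lambda>j. X j \<omega>) n) n c) < 1}" for n \<omega>
  proof -
    have "D n \<omega> = (LINT c|lborel. indicat_real {c \<in> ball 0 R. cmod (pole_sum (all_zeros k \<xi> (\<lambda>j. X j \<omega>) n) n c) < 1} c)"
      unfolding D_def by (intro Bochner_Integration.integral_cong) (auto simp: g_def indicator_def pole_sum_all_zeros[OF kn] S_def)
    thus ?thesis by simp
  qed
  have Dm [measurable]: "D n \<in> borel_measurable M" for n
    unfolding D_def by measurable
  have Dint: "integrable M (D n)" for n
    unfolding D_def using P.integrable_snd[OF gint] by simp
  have D0: "D n \<omega> \<ge> 0" for n \<omega> unfolding D_eq by simp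
  have ED: "expectation (D n) = (LINT c|lborel. indicat_real (ball 0 R) c * prob {\<omega> \<in> space M. cmod (S n \<omega> c) < 1})" for n
  proof -
    have "expectation (D n) = (LINT c|lborel. LINT \<omega>|M. g n c \<omega>)"
      unfolding D_def by (rule P.Fubini_integral[OF gint])
    also have "\<dots> = (LINT c|lborel. indicat_real (ball 0 R) c * prob {\<omega> \<in> space M. cmod (S n \<omega> c) < 1})"
    proof (intro Bochner_Integration.integral_cong refl)
      fix c
      have "(LINT \<omega>|M. g n c \<omega>) = (LINT \<omega>|M. indicat_real (ball 0 R) c * indicat_real {\<omega> \<in> space M. cmod (S n \<omega> c) < 1} \<omega>)"
        by (intro Bochner_Integration.integral_cong) (auto simp: g_def indicator_def)
      thus "(LINT \<omega>|M. g n c \<omega>) = indicat_real (ball 0 R) c * prob {\<omega> \<in> space M. cmod (S n \<omega> c) < 1}"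
        by simp
    qed
    finally show ?thesis .
  qed
  have "(\<lambda>n. expectation (D n)) \<longlonglongrightarrow> (LINT c|(lborel :: complex measure). 0)"
    unfolding ED
  proof (rule integral_dominated_convergence)
    show "integrable lborel (indicat_real (ball (0::complex) R))"
      using emeasure_disc_finite[of 0 R] by simp
    show "AE c in lborel. (\<lambda>n. indicat_real (ball 0 R) c * prob {\<omega> \<in> space M. cmod (S n \<omega> c) < 1}) \<longlonglongrightarrow> 0"
      unfolding S_def
      by (intro AE_I2 tendsto_mult_right_zero prob_iid_complex_sum_small_tendsto_0[OF Xm indep distr nondeg m])
    show "AE c in lborel. norm (indicat_real (ball 0 R) c * prob {\<omega> \<in> space M. cmod (S n \<omega> c) < 1}) \<le> indicat_real (ball (0::complex) R) c" for n
      by (intro AE_I2) (auto simp: indicator_def)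
    show "(\<lambda>c. indicat_real (ball 0 R) c * prob {\<omega> \<in> space M. cmod (S n \<omega> c) < 1}) \<in> borel_measurable lborel" for n
    proof -
      have "(\<lambda>c. LINT \<omega>|M. g n c \<omega>) \<in> borel_measurable lborel" by measurable
      also have "(\<lambda>c. LINT \<omega>|M. g n c \<omega>) = (\<lambda>c. indicat_real (ball 0 R) c * prob {\<omega> \<in> space M. cmod (S n \<omega> c) < 1})"
      proof
        fix c
        have "(LINT \<omega>|M. g n c \<omega>) = (LINT \<omega>|M. indicat_real (ball 0 R) c * indicat_real {\<omega> \<in> space M. cmod (S n \<omega> c) < 1} \<omega>)"
          by (intro Bochner_Integration.integral_cong) (auto simp: g_def indicator_def)
        thus "(LINT \<omega>|M. g n c \<omega>) = indicat_real (ball 0 R) c * prob {\<omega> \<in> space M. cmod (S n \<omega> c) < 1}"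
          by simp
      qed
      finally show ?thesis .
    qed
  qed auto
  hence lim: "(\<lambda>n. expectation (D n) / \<delta>) \<longlonglongrightarrow> 0"
    using tendsto_divide_zero by fastforce
  have "(\<lambda>n. prob {\<omega> \<in> space M. D n \<omega> \<ge> \<delta>}) \<longlonglongrightarrow> 0"
  proof (rule tendsto_sandwich[OF _ _ tendsto_const lim])
    show "\<forall>\<^sub>F n in sequentially. prob {\<omega> \<in> space M. D n \<omega> \<ge> \<delta>} \<le> expectation (D n) / \<delta>"
      using D0 \<delta> by (intro always_eventually allI integral_Markov_inequality_measure[OF Dint sets.top]) auto
  qed auto
  moreover have "{\<omega> \<in> space M. D n \<omega> \<ge> \<delta>} \<in> events" for n by measurable
  ultimately show ?thesis unfolding D_eq[symmetric] by (intro vanishingI)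
qed

end

section \<open>Critical points when nearly all zeros coincide\<close>

lemma sum_mset_bound_off_point:
  fixes g :: "'b \<Rightarrow> real"
  assumes "g y = 0" "\<And>w. \<bar>g w\<bar> \<le> C"
  shows "\<bar>\<Sum>w\<in>#A. g w\<bar> \<le> C * (real (size A) - real (count A y))"
proof (induction A)
  case (add x A)
  thus ?case using assms(1) assms(2)[of x] by (cases "x = y") (auto simp: algebra_simps)
qed simp

lemma sum_mset_abs_le:
  fixes f :: "'b \<Rightarrow> real"
  assumes "\<And>w. \<bar>f w\<bar> \<le> B"
  shows "\<bar>\<Sum>w\<in>#A. f w\<bar> \<le> B * real (size A)"
proof (induction A)
  case (add x A)
  thus ?case using assms[of x] by (auto simp: algebra_simps)
qed simp

lemma deriv_zero_measure_integral_p_poly: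
  assumes "k n \<le> n"
  shows "deriv_zero_measure_integral (p_poly k \<xi> x n) f =
    (\<Sum>w\<in>#proots (pderiv (monic_poly (all_zeros k \<xi> x n) n)). f w) / real (n - 1)"
  unfolding deriv_zero_measure_integral_def zero_measure_integral_eq_proots p_poly_eq_monic_poly[of k n, OF assms] by simp

text \<open>The power \<open>(z - y)^(n - k n)\<close> divides the polynomial, so \<open>y\<close>
  is a critical point of multiplicity at least \<open>n - k n - 1\<close>. At most
  \<open>k n\<close> of the \<open>n - 1\<close> critical points lie elsewhere, and each moves the
  sum by at most \<open>2 * B\<close>.\<close>

lemma deriv_zero_measure_integral_point_mass:
  assumes kn: "k n < n" "n > 1" and x: "\<And>j. x j = y" and B: "\<And>z. \<bar>f z\<bar> \<le> B"
  shows "\<bar>deriv_zero_measure_integral (p_poly k \<xi> x n) f - f y\<bar> \<le> 2 * B * real (k n) / (real n - 1)"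
proof -
  define p where "p = monic_poly (all_zeros k \<xi> x n) n"
  define A where "A = proots (pderiv p)"
  have kn': "k n \<le> n" using kn by simp
  have p0: "p \<noteq> 0" by (simp add: p_def)
  have p'0: "pderiv p \<noteq> 0" using kn by (simp add: p_def pderiv_monic_poly_nonzero)
  have "p = (\<Prod>j<n - k n. [:- y, 1:]) * (\<Prod>l<k n. [:- \<xi> n l, 1:])"
    unfolding p_def p_poly_eq_monic_poly[of k n, OF kn', symmetric] by (simp add: p_poly_def x)
  hence "[:- y, 1:] ^ (n - k n) dvd p" by simp
  hence ord: "order y p \<ge> n - k n" using p0 by (simp add: order_divides)
  \<comment> \<open>\<open>k n < n\<close> makes \<open>y\<close> a zero, so differentiation lowers
    its order by exactly one.\<close>
  hence "poly p y = 0" using kn p0 by (simp add: order_root)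
  hence "order y p = Suc (order y (pderiv p))" using p0 by (intro order_pderiv)
  hence cnt: "real (count A y) \<ge> real n - real (k n) - 1"
    using ord kn p'0 by (simp add: A_def)
  have sizeA: "real (size A) = real n - 1"
    using kn by (simp add: A_def size_proots_complex p_def of_nat_diff)
  have B0: "B \<ge> 0" using B[of 0] by linarith
  have "(\<Sum>w\<in>#A. f w) - real (size A) * f y = (\<Sum>w\<in>#A. f w - f y)"
    by (induction A) (auto simp: algebra_simps)
  also have "\<bar>\<dots>\<bar> \<le> 2 * B * (real (size A) - real (count A y))"
  proof (rule sum_mset_bound_off_point)
    show "\<bar>f w - f y\<bar> \<le> 2 * B" for w using B[of w] B[of y] by linarith
  qed simp
  also have "\<dots> \<le> 2 * B * real (k n)"
    using cnt sizeA B0 by (intro mult_left_mono) auto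
  finally have "\<bar>(\<Sum>w\<in>#A. f w) - (real n - 1) * f y\<bar> \<le> 2 * B * real (k n)" by (simp add: sizeA)
  hence "\<bar>(\<Sum>w\<in>#A. f w) - (real n - 1) * f y\<bar> / (real n - 1) \<le> 2 * B * real (k n) / (real n - 1)"
    using kn by (intro divide_right_mono) auto
  moreover have "\<bar>(\<Sum>w\<in>#A. f w) - (real n - 1) * f y\<bar> / (real n - 1) = \<bar>(\<Sum>w\<in>#A. f w) / (real n - 1) - f y\<bar>"
  proof -
    have "(\<Sum>w\<in>#A. f w) / (real n - 1) - f y = ((\<Sum>w\<in>#A. f w) - (real n - 1) * f y) / (real n - 1)"
      using kn by (simp add: field_simps)
    thus ?thesis using kn by (simp add: abs_divide)
  qed
  ultimately show ?thesis
    using kn by (simp add: deriv_zero_measure_integral_p_poly[of k n, OF kn'] A_def p_def of_nat_diff)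
qed

section \<open>From compactly supported to bounded test functions\<close>

context prob_space
begin

text \<open>Outside the events of large bad area and of a deviating sample mean, four errors of size
  \<open>e / 4\<close> add up: normalisation by \<open>n - 1\<close> instead of \<open>n\<close>,
  critical points against zeros, prescribed against sampled zeros, and sample mean against
  integral.\<close>

lemma vanishing_deriv_zero_measure_compact:
  fixes X :: "nat \<Rightarrow> 'a \<Rightarrow> complex" and f :: "complex \<Rightarrow> real" and e :: real
  assumes Xm: "\<And>i. X i \<in> borel_measurable M"
    and indep: "indep_vars (\<lambda>_. borel) X UNIV"
    and distr: "\<And>i. distr M borel (X i) = \<mu>"
    and nondeg: "\<And>y. \<not> (AE x in \<mu>. x = y)"
    and kn: "\<And>n. k n \<le> n" and ko: "(\<lambda>n. real (k n) / real n) \<longlonglongrightarrow> 0"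
    and m: "filterlim (\<lambda>n. n - k n) at_top sequentially"
    and f: "continuous_on UNIV f" and B: "\<And>z. \<bar>f z\<bar> \<le> B"
    and supp: "\<And>z. cmod z \<ge> R \<Longrightarrow> f z = 0" and e: "e > 0"
  shows "vanishing (\<lambda>n. {\<omega> \<in> space M.
      \<bar>deriv_zero_measure_integral (p_poly k \<xi> (\<lambda>j. X j \<omega>) n) f - integral\<^sup>L \<mu> f\<bar> > e})"
proof -
  have e4: "e / 4 > 0" using e by simp
  obtain R' \<delta> where \<delta>: "\<delta> > 0" and close:
    "\<forall>\<^sub>F n in sequentially. \<forall>a. measure lborel {c \<in> ball 0 R'. cmod (pole_sum a n c) < 1} \<le> \<delta> \<longrightarrow>
       \<bar>(\<Sum>w\<in>#proots (pderiv (monic_poly a n)). f w) - (\<Sum>i<n. f (a i))\<bar> \<le> e / 4 * real n"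
    using critical_points_close[OF f B supp e4] by blast
  have B0: "B \<ge> 0" using B[of 0] by linarith
  have fm: "f \<in> borel_measurable borel" using f by (rule borel_measurable_continuous_onI)
  define bad where "bad = (\<lambda>n. {\<omega> \<in> space M.
    measure lborel {c \<in> ball 0 R'. cmod (pole_sum (all_zeros k \<xi> (\<lambda>j. X j \<omega>) n) n c) < 1} \<ge> \<delta>})"
  define dev where "dev = (\<lambda>n. {\<omega> \<in> space M. \<bar>(\<Sum>i<n. f (X i \<omega>)) / n - integral\<^sup>L \<mu> f\<bar> \<ge> e / 4})"
  have "vanishing bad" unfolding bad_def
    by (rule vanishing_bad_centres[OF Xm indep distr nondeg kn m \<delta>])
  moreover have "vanishing dev" unfolding dev_def
    using e by (intro vanishing_sampled_mean[OF Xm indep distr fm B]) auto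
  ultimately have van: "vanishing (\<lambda>n. bad n \<union> dev n)" by (rule vanishing_Un)
  have "(\<lambda>n. B * (1 / real n)) \<longlonglongrightarrow> B * 0" by (intro tendsto_intros lim_1_over_n)
  hence ev1: "\<forall>\<^sub>F n in sequentially. B * (1 / real n) < e / 4"
    by (rule order_tendstoD) (use e in simp)
  have "(\<lambda>n. 2 * B * (real (k n) / real n)) \<longlonglongrightarrow> 2 * B * 0" by (intro tendsto_intros ko)
  hence ev2: "\<forall>\<^sub>F n in sequentially. 2 * B * (real (k n) / real n) < e / 4"
    by (rule order_tendstoD) (use e in simp)
  show ?thesis
  proof (rule vanishing_mono[OF van])
    show "\<forall>\<^sub>F n in sequentially. {\<omega> \<in> space M.
      \<bar>deriv_zero_measure_integral (p_poly k \<xi> (\<lambda>j. X j \<omega>) n) f - integral\<^sup>L \<mu> f\<bar> > e} \<subseteq> bad n \<union> dev n"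
      using close ev1 ev2 eventually_gt_at_top[of 1]
    proof eventually_elim
      case (elim n)
      show ?case
      proof (rule subsetI, rule ccontr)
        fix \<omega> assume \<omega>: "\<omega> \<in> {\<omega> \<in> space M. \<bar>deriv_zero_measure_integral (p_poly k \<xi> (\<lambda>j. X j \<omega>) n) f - integral\<^sup>L \<mu> f\<bar> > e}"
          and "\<omega> \<notin> bad n \<union> dev n"
        hence nb: "measure lborel {c \<in> ball 0 R'. cmod (pole_sum (all_zeros k \<xi> (\<lambda>j. X j \<omega>) n) n c) < 1} \<le> \<delta>"
          and nd: "\<bar>(\<Sum>i<n. f (X i \<omega>)) / n - integral\<^sup>L \<mu> f\<bar> < e / 4"
          by (auto simp: bad_def dev_def)
        define a where "a = all_zeros k \<xi> (\<lambda>j. X j \<omega>) n"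
        define Z where "Z = (\<Sum>w\<in>#proots (pderiv (monic_poly a n)). f w)"
        define Q where "Q = (\<Sum>i<n. f (a i))"
        \<comment> \<open>The sample sum runs over all \<open>n\<close> indices; the last
          \<open>k n\<close> of these variables do not occur in the polynomial, and exchanging them
          for the prescribed zeros costs at most \<open>2 * B\<close> each.\<close>
        define T where "T = (\<Sum>i<n. f (X i \<omega>))"
        have n: "real n > 1" using elim by simp
        have 1: "\<bar>Z - Q\<bar> \<le> e / 4 * n" using elim(1) nb unfolding Z_def Q_def a_def by blast
        have 2: "\<bar>Z\<bar> \<le> B * (real n - 1)"
          using sum_mset_abs_le[OF B, where A = "proots (pderiv (monic_poly a n))"] n
          by (simp add: Z_def size_proots_complex of_nat_diff)
        have 3: "\<bar>Q - T\<bar> \<le> 2 * B * real (k n)"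
        proof -
          have "Q - T = (\<Sum>i<n. f (a i) - f (X i \<omega>))" by (simp add: Q_def T_def sum_subtractf)
          also have "\<bar>\<dots>\<bar> \<le> (\<Sum>i<n. \<bar>f (a i) - f (X i \<omega>)\<bar>)" by (rule sum_abs)
          also have "\<dots> \<le> (\<Sum>i<n. if i < n - k n then 0 else 2 * B)"
          proof (rule sum_mono)
            fix i
            have "\<bar>f (a i) - f (X i \<omega>)\<bar> \<le> 2 * B" using B[of "a i"] B[of "X i \<omega>"] by linarith
            thus "\<bar>f (a i) - f (X i \<omega>)\<bar> \<le> (if i < n - k n then 0 else 2 * B)"
              by (auto simp: a_def all_zeros_def)
          qed
          also have "\<dots> = (\<Sum>i\<in>{n - k n..<n}. 2 * B)"
            by (rule sum.mono_neutral_cong_right) auto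
          also have "\<dots> = 2 * B * real (k n)" using kn[of n] by simp
          finally show ?thesis .
        qed
        have "\<bar>Z / (real n - 1) - Z / n\<bar> \<le> B / n"
        proof -
          have "Z / (real n - 1) - Z / n = Z / ((real n - 1) * n)" using n by (simp add: field_simps)
          hence "\<bar>Z / (real n - 1) - Z / n\<bar> = \<bar>Z\<bar> / ((real n - 1) * n)" using n by (simp add: abs_mult)
          also have "\<dots> \<le> B * (real n - 1) / ((real n - 1) * n)" using 2 n by (intro divide_right_mono) auto
          also have "\<dots> = B / n" using n by simp
          finally show ?thesis .
        qed
        moreover have "\<bar>Z / n - Q / n\<bar> \<le> e / 4"
          using 1 n by (simp add: diff_divide_distrib[symmetric] abs_divide divide_le_eq)
        moreover have "\<bar>Q / n - T / n\<bar> \<le> 2 * B * (real (k n) / real n)"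
          using 3 n by (simp add: diff_divide_distrib[symmetric] abs_divide divide_right_mono)
        moreover have "deriv_zero_measure_integral (p_poly k \<xi> (\<lambda>j. X j \<omega>) n) f = Z / (real n - 1)"
          using n by (simp add: deriv_zero_measure_integral_p_poly[of k n, OF kn] Z_def a_def of_nat_diff)
        moreover have "B / n < e / 4" using elim(2) by simp
        moreover have "\<bar>Z / (real n - 1) - integral\<^sup>L \<mu> f\<bar> > e" using \<omega> calculation(4) by simp
        ultimately show False
          using nd elim(3) unfolding T_def by linarith
      qed
    qed
  qed
qed

text \<open>Tightness by truncation: the compactly supported case is applied to \<open>f\<close>
  times a cut-off and also to the cut-off itself. The latter shows that few critical points lie
  where the cut-off is far below 1, so truncating \<open>f\<close> changes both integrals
  little.\<close>

lemma vanishing_deriv_zero_measure_bounded: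
  fixes X :: "nat \<Rightarrow> 'a \<Rightarrow> complex" and f :: "complex \<Rightarrow> real" and e :: real
  assumes Xm: "\<And>i. X i \<in> borel_measurable M"
    and indep: "indep_vars (\<lambda>_. borel) X UNIV"
    and distr: "\<And>i. distr M borel (X i) = \<mu>"
    and nondeg: "\<And>y. \<not> (AE x in \<mu>. x = y)"
    and kn: "\<And>n. k n \<le> n" and ko: "(\<lambda>n. real (k n) / real n) \<longlonglongrightarrow> 0"
    and m: "filterlim (\<lambda>n. n - k n) at_top sequentially"
    and f: "continuous_on UNIV f" and B: "\<And>z. \<bar>f z\<bar> \<le> B" and e: "e > 0"
  shows "vanishing (\<lambda>n. {\<omega> \<in> space M.
      \<bar>deriv_zero_measure_integral (p_poly k \<xi> (\<lambda>j. X j \<omega>) n) f - integral\<^sup>L \<mu> f\<bar> > e})"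
proof -
  have B0: "B \<ge> 0" using B[of 0] by linarith
  interpret \<mu>: prob_space \<mu> unfolding distr[of 0, symmetric] by (rule prob_space_distr[OF Xm])
  have sets: "sets \<mu> = sets borel" unfolding distr[of 0, symmetric] by simp
  have fm [measurable]: "f \<in> borel_measurable borel" using f by (rule borel_measurable_continuous_onI)
  define cut where "cut = (\<lambda>R::nat. \<lambda>z::complex. max 0 (min 1 (real R + 1 - cmod z)))"
  have cut01: "0 \<le> cut R z" "cut R z \<le> 1" for R z by (auto simp: cut_def)
  have cutc: "continuous_on UNIV (cut R)" for R unfolding cut_def by (intro continuous_intros)
  have cutm [measurable]: "cut R \<in> borel_measurable \<mu>" for R
    using borel_measurable_continuous_onI[OF cutc] by (simp add: measurable_cong_sets[OF sets refl])
  have fm\<mu> [measurable]: "f \<in> borel_measurable \<mu>"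
    by (simp add: measurable_cong_sets[OF sets refl])
  have cutsupp: "cut R z = 0" if "cmod z \<ge> real R + 1" for R z using that by (simp add: cut_def)
  have "(\<lambda>R. integral\<^sup>L \<mu> (cut R)) \<longlonglongrightarrow> integral\<^sup>L \<mu> (\<lambda>_. 1)"
  proof (rule integral_dominated_convergence[where w = "\<lambda>_. 1"])
    show "AE z in \<mu>. (\<lambda>R. cut R z) \<longlonglongrightarrow> 1"
    proof (intro AE_I2 tendsto_eventually)
      fix z
      show "\<forall>\<^sub>F R in sequentially. cut R z = 1"
        using eventually_ge_at_top[of "nat \<lceil>cmod z\<rceil>"]
        by eventually_elim (auto simp: cut_def)
    qed
    show "AE z in \<mu>. norm (cut R z) \<le> 1" for R using cut01 by (intro AE_I2) auto
  qed auto
  hence lim: "(\<lambda>R. integral\<^sup>L \<mu> (cut R)) \<longlonglongrightarrow> 1" by (simp add: \<mu>.prob_space)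
  have "\<forall>\<^sub>F R in sequentially. integral\<^sup>L \<mu> (cut R) > 1 - e / (8 * (B + 1))"
    by (rule order_tendstoD[OF lim]) (use e B0 in \<open>auto intro!: divide_pos_pos\<close>)
  then obtain R where R: "integral\<^sup>L \<mu> (cut R) > 1 - e / (8 * (B + 1))"
    using eventually_happens'[OF sequentially_bot] by blast
  \<comment> \<open>The mass of \<open>\<mu>\<close> removed by the cut-off.\<close>
  define c where "c = 1 - integral\<^sup>L \<mu> (cut R)"
  have Bc: "2 * B * c \<le> e / 4"
  proof -
    have c: "c < e / (8 * (B + 1))" using R by (simp add: c_def)
    have "B * c \<le> B * (e / (8 * (B + 1)))" using c B0 by (intro mult_left_mono) auto
    also have "\<dots> \<le> e / 8" using B0 e by (simp add: field_simps)
    finally show ?thesis by simp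
  qed
  let ?Z = "\<lambda>n \<omega> f. deriv_zero_measure_integral (p_poly k \<xi> (\<lambda>j. X j \<omega>) n) f"
  let ?g = "\<lambda>z. f z * cut R z"
  have gB: "\<bar>?g z\<bar> \<le> B" for z
  proof -
    have "\<bar>?g z\<bar> = \<bar>f z\<bar> * cut R z" using cut01[of R z] by (simp add: abs_mult)
    also have "\<dots> \<le> B * 1" using B B0 cut01 by (intro mult_mono) auto
    finally show ?thesis by simp
  qed
  have v1: "vanishing (\<lambda>n. {\<omega> \<in> space M. \<bar>?Z n \<omega> ?g - integral\<^sup>L \<mu> ?g\<bar> > e / 4})"
    using e gB cutsupp
    by (intro vanishing_deriv_zero_measure_compact[OF Xm indep distr nondeg kn ko m, where R = "real R + 1"]
        continuous_on_mult f cutc) auto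
  have v2: "vanishing (\<lambda>n. {\<omega> \<in> space M. \<bar>?Z n \<omega> (cut R) - integral\<^sup>L \<mu> (cut R)\<bar> > e / (4 * (B + 1))})"
    using e B0 cut01 cutsupp
    by (intro vanishing_deriv_zero_measure_compact[OF Xm indep distr nondeg kn ko m, where R = "real R + 1" and B = 1] cutc)
       auto
  have intf: "integrable \<mu> f" by (rule \<mu>.integrable_const_bound[of _ B]) (use B in auto)
  have intcut: "integrable \<mu> (cut R)" by (rule \<mu>.integrable_const_bound[of _ 1]) (use cut01 in auto)
  have intg: "integrable \<mu> ?g" by (rule \<mu>.integrable_const_bound[of _ B]) (use gB in auto)
  have pt: "\<bar>f z - ?g z\<bar> \<le> B * (1 - cut R z)" for z
  proof -
    have "f z - ?g z = f z * (1 - cut R z)" by (simp add: algebra_simps)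
    hence "\<bar>f z - ?g z\<bar> = \<bar>f z\<bar> * (1 - cut R z)" using cut01[of R z] by (simp add: abs_mult)
    also have "\<dots> \<le> B * (1 - cut R z)" using B cut01[of R z] by (intro mult_right_mono) auto
    finally show ?thesis .
  qed
  have int_diff: "\<bar>integral\<^sup>L \<mu> f - integral\<^sup>L \<mu> ?g\<bar> \<le> B * c"
  proof -
    have "\<bar>integral\<^sup>L \<mu> f - integral\<^sup>L \<mu> ?g\<bar> = \<bar>LINT z|\<mu>. f z - ?g z\<bar>" using intf intg by simp
    also have "\<dots> \<le> (LINT z|\<mu>. \<bar>f z - ?g z\<bar>)" by (rule integral_abs_bound)
    also have "\<dots> \<le> (LINT z|\<mu>. B * (1 - cut R z))"
      using pt intf intg intcut by (intro integral_mono) auto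
    also have "\<dots> = B * c" using intcut by (simp add: c_def \<mu>.prob_space)
    finally show ?thesis .
  qed
  show ?thesis
  proof (rule vanishing_mono[OF vanishing_Un[OF v1 v2]])
    show "\<forall>\<^sub>F n in sequentially. {\<omega> \<in> space M. \<bar>?Z n \<omega> f - integral\<^sup>L \<mu> f\<bar> > e}
       \<subseteq> {\<omega> \<in> space M. \<bar>?Z n \<omega> ?g - integral\<^sup>L \<mu> ?g\<bar> > e / 4} \<union>
         {\<omega> \<in> space M. \<bar>?Z n \<omega> (cut R) - integral\<^sup>L \<mu> (cut R)\<bar> > e / (4 * (B + 1))}"
      using eventually_gt_at_top[of 1]
    proof eventually_elim
      case (elim n)
      show ?case
      proof (rule subsetI, rule ccontr)
        fix \<omega> assume \<omega>: "\<omega> \<in> {\<omega> \<in> space M. \<bar>?Z n \<omega> f - integral\<^sup>L \<mu> f\<bar> > e}"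
          and n: "\<omega> \<notin> {\<omega> \<in> space M. \<bar>?Z n \<omega> ?g - integral\<^sup>L \<mu> ?g\<bar> > e / 4} \<union>
         {\<omega> \<in> space M. \<bar>?Z n \<omega> (cut R) - integral\<^sup>L \<mu> (cut R)\<bar> > e / (4 * (B + 1))}"
        have 1: "\<bar>?Z n \<omega> ?g - integral\<^sup>L \<mu> ?g\<bar> \<le> e / 4" using \<omega> n by auto
        have 2: "\<bar>?Z n \<omega> (cut R) - integral\<^sup>L \<mu> (cut R)\<bar> \<le> e / (4 * (B + 1))" using \<omega> n by auto
        define A where "A = proots (pderiv (monic_poly (all_zeros k \<xi> (\<lambda>j. X j \<omega>) n) n))"
        have N: "real n - 1 > 0" using elim by simp
        have Z: "?Z n \<omega> h = (\<Sum>w\<in>#A. h w) / (real n - 1)" for h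
          using elim by (simp add: deriv_zero_measure_integral_p_poly[of k n, OF kn] A_def of_nat_diff)
        have sizeA: "real (size A) = real n - 1"
          using elim by (simp add: A_def size_proots_complex of_nat_diff)
        have "\<bar>(\<Sum>w\<in>#A. f w) - (\<Sum>w\<in>#A. ?g w)\<bar> \<le> B * (real (size A) - (\<Sum>w\<in>#A. cut R w))" for A
        proof (induction A)
          case (add x A)
          show ?case using add.IH pt[of x] by (simp add: algebra_simps)
        qed simp
        hence "\<bar>(\<Sum>w\<in>#A. f w) - (\<Sum>w\<in>#A. ?g w)\<bar> \<le> B * ((real n - 1) - (\<Sum>w\<in>#A. cut R w))"
          using sizeA by metis
        hence "\<bar>(\<Sum>w\<in>#A. f w) - (\<Sum>w\<in>#A. ?g w)\<bar> / (real n - 1) \<le> B * ((real n - 1) - (\<Sum>w\<in>#A. cut R w)) / (real n - 1)"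
          using N by (intro divide_right_mono) auto
        moreover have "\<bar>(\<Sum>w\<in>#A. f w) - (\<Sum>w\<in>#A. ?g w)\<bar> / (real n - 1) = \<bar>?Z n \<omega> f - ?Z n \<omega> ?g\<bar>"
          using N by (simp add: Z diff_divide_distrib[symmetric] abs_divide)
        moreover have "B * ((real n - 1) - (\<Sum>w\<in>#A. cut R w)) / (real n - 1) = B * (1 - ?Z n \<omega> (cut R))"
          using N by (simp add: Z field_simps)
        ultimately have 3: "\<bar>?Z n \<omega> f - ?Z n \<omega> ?g\<bar> \<le> B * (1 - ?Z n \<omega> (cut R))" by simp
        have "1 - ?Z n \<omega> (cut R) \<le> c + e / (4 * (B + 1))" using 2 by (simp add: c_def abs_le_iff)
        hence "B * (1 - ?Z n \<omega> (cut R)) \<le> B * (c + e / (4 * (B + 1)))" using B0 by (intro mult_left_mono) auto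
        also have "\<dots> = B * c + B * (e / (4 * (B + 1)))" by (simp add: algebra_simps)
        also have "B * (e / (4 * (B + 1))) \<le> e / 4" using B0 e by (simp add: field_simps)
        finally have 4: "B * (1 - ?Z n \<omega> (cut R)) \<le> B * c + e / 4" by simp
        have "\<bar>?Z n \<omega> f - integral\<^sup>L \<mu> f\<bar> \<le> \<bar>?Z n \<omega> f - ?Z n \<omega> ?g\<bar> + \<bar>?Z n \<omega> ?g - integral\<^sup>L \<mu> ?g\<bar> + \<bar>integral\<^sup>L \<mu> f - integral\<^sup>L \<mu> ?g\<bar>"
          by linarith
        \<comment> \<open>The total is \<open>2 * B * c + e / 2\<close>, which is at most
          \<open>3 * e / 4\<close>.\<close>
        also have "\<dots> \<le> (B * c + e / 4) + e / 4 + B * c" using 1 3 4 int_diff by linarith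
        also have "\<dots> \<le> e" using Bc e by linarith
        finally show False using \<omega> by simp
      qed
    qed
  qed
qed

end

theorem mainTheorem13:
  fixes M :: "'a measure" and \<mu> :: "complex measure"
    and X :: "nat \<Rightarrow> 'a \<Rightarrow> complex"
    and k :: "nat \<Rightarrow> nat" and \<xi> :: "nat \<Rightarrow> nat \<Rightarrow> complex" and E :: "complex set"
  assumes "prob_space M" and "prob_space \<mu>" and "sets \<mu> = sets borel"
    and "\<And>i. X i \<in> borel_measurable M"
    and "prob_space.indep_vars M (\<lambda>_. borel) X UNIV"
    and "\<And>i. distr M borel (X i) = \<mu>"
    and "\<And>n. k n \<le> n"
    and "(\<lambda>n. real (k n)) \<in> o(\<lambda>n. real n)"
    and "E \<in> null_sets lebesgue"
    and "\<And>z. z \<notin> E \<Longrightarrow>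
           limsup (\<lambda>n. ereal (1 / real n) * (\<Sum>l<k n. log_minus (cmod (z - \<xi> n l)))) = 0"
  shows "\<forall>f :: complex \<Rightarrow> real. continuous_on UNIV f \<and> bounded (range f) \<longrightarrow>
           (\<forall>\<epsilon>>0. (\<lambda>n. measure M {\<omega> \<in> space M.
               \<bar>deriv_zero_measure_integral (p_poly k \<xi> (\<lambda>j. X j \<omega>) n) f - integral\<^sup>L \<mu> f\<bar> > \<epsilon>})
             \<longlonglongrightarrow> 0)"
proof (intro allI impI)
  fix f :: "complex \<Rightarrow> real" and \<epsilon> :: real
  assume "continuous_on UNIV f \<and> bounded (range f)" and \<epsilon>: "\<epsilon> > 0"
  hence f: "continuous_on UNIV f" and "bounded (range f)" by auto
  then obtain B where B: "\<And>z. \<bar>f z\<bar> \<le> B"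
    unfolding bounded_iff by auto
  interpret prob_space M by fact
  note Xm = assms(4) and indep = assms(5) and distr = assms(6) and kn = assms(7)
  have ko: "(\<lambda>n. real (k n) / real n) \<longlonglongrightarrow> 0"
    by (rule smalloD_tendsto[OF assms(8)])
  have half: "\<forall>\<^sub>F n in sequentially. real (k n) / real n < 1 / 2"
    by (rule order_tendstoD[OF ko]) simp
  \<comment> \<open>The number of independent summands tends to infinity, as eventually fewer than
    half of the zeros are prescribed.\<close>
  have m: "filterlim (\<lambda>n. n - k n) at_top sequentially"
  proof (rule filterlim_at_top_mono)
    show "filterlim (\<lambda>n::nat. n div 2) at_top sequentially"
      by (rule filterlim_at_top_div_const_nat) simp
    show "\<forall>\<^sub>F n in sequentially. n div 2 \<le> n - k n"
      using half eventually_gt_at_top[of 0]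
    proof eventually_elim
      case (elim n)
      hence "2 * k n < n" by (simp add: field_simps)
      thus ?case by simp
    qed
  qed
  have "vanishing (\<lambda>n. {\<omega> \<in> space M.
      \<bar>deriv_zero_measure_integral (p_poly k \<xi> (\<lambda>j. X j \<omega>) n) f - integral\<^sup>L \<mu> f\<bar> > \<epsilon>})"
  proof (cases "\<exists>y. AE x in \<mu>. x = y")
    case False
    thus ?thesis
      by (intro vanishing_deriv_zero_measure_bounded[OF Xm indep distr _ kn ko m f B \<epsilon>]) auto
  next
    case True
    then obtain y where y: "AE x in \<mu>. x = y" by blast
    interpret \<mu>: prob_space \<mu> by fact
    have fm: "f \<in> borel_measurable borel" using f by (rule borel_measurable_continuous_onI)
    have "integral\<^sup>L \<mu> f = integral\<^sup>L \<mu> (\<lambda>_. f y)"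
      using y fm by (intro integral_cong_AE) (auto simp: measurable_cong_sets[OF assms(3) refl])
    hence If: "integral\<^sup>L \<mu> f = f y" by (simp add: \<mu>.prob_space)
    have "AE \<omega> in M. X i \<omega> = y" for i
      using y unfolding distr[of i, symmetric] by (rule AE_distrD[OF Xm])
    \<comment> \<open>Countably many almost sure equalities hold outside a single null set
      \<open>N\<close>. Off \<open>N\<close> the estimate is deterministic, so the constant sequence
      \<open>N\<close> is a majorant of probability zero.\<close>
    hence "AE \<omega> in M. \<forall>i. X i \<omega> = y" by (simp add: AE_all_countable)
    then obtain N where N: "N \<in> null_sets M" "{\<omega> \<in> space M. \<not> (\<forall>i. X i \<omega> = y)} \<subseteq> N"
      by (auto elim!: AE_E intro: null_setsI)
    \<comment> \<open>The inner factor \<open>2\<close> absorbs the denominator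
      \<open>n - 1\<close>, which is at least \<open>n / 2\<close> for \<open>n > 1\<close>.\<close>
    have "(\<lambda>n. 2 * B * (2 * (real (k n) / real n))) \<longlonglongrightarrow> 2 * B * (2 * 0)" by (intro tendsto_intros ko)
    hence ev: "\<forall>\<^sub>F n in sequentially. 2 * B * (2 * (real (k n) / real n)) < \<epsilon>"
      by (rule order_tendstoD) (use \<epsilon> in simp)
    have B0: "B \<ge> 0" using B[of 0] by linarith
    show ?thesis
    proof (rule vanishing_mono)
      show "vanishing (\<lambda>n. N)" using N(1) by (intro vanishingI) (auto simp: measure_eq_0_null_sets)
      show "\<forall>\<^sub>F n in sequentially. {\<omega> \<in> space M.
        \<bar>deriv_zero_measure_integral (p_poly k \<xi> (\<lambda>j. X j \<omega>) n) f - integral\<^sup>L \<mu> f\<bar> > \<epsilon>} \<subseteq> N"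
        using ev half eventually_gt_at_top[of 1]
      proof eventually_elim
        case (elim n)
        have kn': "k n < n" using elim by (simp add: field_simps)
        have "\<omega> \<in> N" if \<omega>: "\<omega> \<in> space M"
          "\<bar>deriv_zero_measure_integral (p_poly k \<xi> (\<lambda>j. X j \<omega>) n) f - integral\<^sup>L \<mu> f\<bar> > \<epsilon>" for \<omega>
        proof (rule ccontr)
          assume "\<omega> \<notin> N"
          hence x: "X j \<omega> = y" for j using N(2) \<omega>(1) by blast
          have "\<bar>deriv_zero_measure_integral (p_poly k \<xi> (\<lambda>j. X j \<omega>) n) f - f y\<bar> \<le> 2 * B * real (k n) / (real n - 1)"
            using kn' elim x B by (intro deriv_zero_measure_integral_point_mass) auto
          also have "\<dots> = 2 * B * (real (k n) / (real n - 1))" by simp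
          also have "\<dots> \<le> 2 * B * (2 * (real (k n) / real n))"
          proof (intro mult_left_mono)
            have "real (k n) / (real n - 1) \<le> real (k n) / (real n / 2)"
              using elim(3) by (intro divide_left_mono) auto
            thus "real (k n) / (real n - 1) \<le> 2 * (real (k n) / real n)" by (simp add: mult.commute)
          qed (use B0 in auto)
          finally show False using \<omega>(2) elim(1) If by simp
        qed
        thus ?case by blast
      qed
    qed
  qed
  thus "(\<lambda>n. measure M {\<omega> \<in> space M.
      \<bar>deriv_zero_measure_integral (p_poly k \<xi> (\<lambda>j. X j \<omega>) n) f - integral\<^sup>L \<mu> f\<bar> > \<epsilon>}) \<longlonglongrightarrow> 0"
    by (rule vanishing_imp_tendsto)
qed

end
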